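(* Let the regularity assumption (with constants $L,\kappa_H$) and the unbiasedness assumption stated in the context hold, and let $\mu_1,\gamma\in(0,1]$. There exist constants $\mu_0,v_0\in(0,1)$ (not depending on $N$, on $K$ or on the particular functions $f_i$) such that, if TRSVR is run with $$\alpha=\frac{\mu_0 b}{2(L+2\kappa_H)N^{\gamma}}\in(0,1],\qquad b=\mu_1N^{\gamma},\qquad S\le\left\lfloor\frac{N^{3\gamma/2}}{\mu_0\left(b+\frac{\mu_0L^2b}{2(L+2\kappa_H)}\right)}\right\rfloor ,$$ then for every integer $K\ge 0$, $$\mathbb{E}\left[\frac{1}{(K+1)S}\sum_{k=0}^{K}\sum_{s=0}^{S-1}\|g_{k,s}\|^2\right]\le\frac{2(L+\kappa_H)\left(\mathbb{E}[f(\boldsymbol{x}_{0,0})]-f_{\inf}\right)}{(K+1)S\,\mu_0\,\mu_1\,v_0}.$$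
   Context: Problem. Minimize $f(\boldsymbol{x})=\frac1N\sum_{i=1}^N f_i(\boldsymbol{x})$ over $\boldsymbol{x}\in\mathbb{R}^d$; $g(\boldsymbol{x})=\nabla f(\boldsymbol{x})$ is the full gradient. $\|\cdot\|$ is the $\ell_2$ norm for vectors and the operator norm for matrices; $[N]=\{1,\dots,N\}$. Algorithm TRSVR (Trust-Region with Stochastic Variance Reduction). Inputs: initial point $\boldsymbol{x}_{0,0}$, batch size $b\in[1,N]$, integer inner-loop length $S>0$, radius-control parameter $\alpha>0$. For $k=0,1,2,\dots$: compute the full gradient $g_{k,0}=\frac1N\sum_{i=1}^N\nabla f_i(\boldsymbol{x}_{k,0})$; then for $s=0,\dots,S-1$: (1) select a mini-batch $I_{k,s}\subset[N]$ of size $b$, compute the mini-batch gradient $\tilde g_{k,s}=\frac1b\sum_{i\in I_{k,s}}\nabla f_i(\boldsymbol{x}_{k,s})$ and the variance-reduced gradient $\bar g_{k,s}=\frac1b\sum_{i\in I_{k,s}}\left(\nabla f_i(\boldsymbol{x}_{k,s})-\nabla f_i(\boldsymbol{x}_{k,0})\right)+g_{k,0}$; (2) set the trust-region radius $\Delta_{k,s}=\alpha\|\bar g_{k,s}\|$; (3) construct a Hessian approximation $H_{k,s}$ (a $d\times d$ matrix, which may be stochastic and may depend on $\bar g_{k,s}$) and compute an approximate solution $\Delta\boldsymbol{x}_{k,s}$ of the problem of minimizing $m(\Delta\boldsymbol{x})=\bar g_{k,s}^T\Delta\boldsymbol{x}+\frac12\Delta\boldsymbol{x}^TH_{k,s}\Delta\boldsymbol{x}$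 subject to $\|\Delta\boldsymbol{x}\|\le\Delta_{k,s}$, which is feasible and achieves at least as much reduction in $m$ as the Cauchy point (the minimizer of $m$ over the feasible points of the form $-t\bar g_{k,s}$, $t\ge0$); (4) set $\boldsymbol{x}_{k,s+1}=\boldsymbol{x}_{k,s}+\Delta\boldsymbol{x}_{k,s}$. After the inner loop set $\boldsymbol{x}_{k+1,0}=\boldsymbol{x}_{k,S}$. Write $g_{k,s}=g(\boldsymbol{x}_{k,s})$. Regularity assumption. All iterates $\boldsymbol{x}_{k,s}$ lie in an open convex set $\mathcal{X}\subseteq\mathbb{R}^d$; $f$ is bounded below by $f_{\inf}$; each $f_i:\mathbb{R}^d\to\mathbb{R}$, $i\in[N]$, is continuously differentiable with $L$-Lipschitz continuous gradient; and, for some constant $\kappa_H$, $\|H_{k,s}\|\le\kappa_H$ for all $k\ge0$ and $0\le s\le S-1$. Unbiasedness assumption. The mini-batch gradient estimator is unbiased: $\mathbb{E}[\tilde g_{k,s}\mid\boldsymbol{x}_{k,s}]=g_{k,s}$.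
   Formalization: The mini-batch is taken to be a uniformly random size-b subset of [N], independent of all earlier iterates and batches; under the unbiasedness assumption alone the claim fails (e.g. a fair coin choosing between two fixed disjoint half-batches with opposite curvature). *)

theory Defs
  imports "HOL-Probability.Probability"
begin

definition gradient :: "('a::real_inner \<Rightarrow> real) \<Rightarrow> 'a \<Rightarrow> 'a" where
  "gradient h y = (THE D. GDERIV h y :> D)"

definition avg :: "nat \<Rightarrow> (nat \<Rightarrow> 'a \<Rightarrow> real) \<Rightarrow> 'a \<Rightarrow> real" where
  "avg N f y = (1 / real N) * (\<Sum>i=1..N. f i y)"

definition minibatch_gradient ::
  "nat \<Rightarrow> (nat \<Rightarrow> 'a::real_inner \<Rightarrow> real) \<Rightarrow> nat set \<Rightarrow> 'a \<Rightarrow> 'a" where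
  "minibatch_gradient b f J y = (1 / real b) *\<^sub>R (\<Sum>i\<in>J. gradient (f i) y)"

text \<open>The variance-reduced gradient at \<open>y\<close> with outer iterate \<open>y0\<close> as reference point.\<close>

definition vr_gradient ::
  "nat \<Rightarrow> nat \<Rightarrow> (nat \<Rightarrow> 'a::real_inner \<Rightarrow> real) \<Rightarrow> nat set \<Rightarrow> 'a \<Rightarrow> 'a \<Rightarrow> 'a" where
  "vr_gradient N b f J y y0 =
     (1 / real b) *\<^sub>R (\<Sum>i\<in>J. gradient (f i) y - gradient (f i) y0)
     + (1 / real N) *\<^sub>R (\<Sum>i=1..N. gradient (f i) y0)"

definition model :: "real^'d \<Rightarrow> real^'d^'d \<Rightarrow> real^'d \<Rightarrow> real" where
  "model q A p = q \<bullet> p + (1/2) * (p \<bullet> (A *v p))"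

definition is_cauchy_point :: "real^'d \<Rightarrow> real^'d^'d \<Rightarrow> real \<Rightarrow> real^'d \<Rightarrow> bool" where
  "is_cauchy_point q A r c \<longleftrightarrow>
     is_arg_min (model q A) (\<lambda>p. norm p \<le> r \<and> (\<exists>t\<ge>0. p = - (t *\<^sub>R q))) c"

definition approx_tr_solution :: "real^'d \<Rightarrow> real^'d^'d \<Rightarrow> real \<Rightarrow> real^'d \<Rightarrow> bool" where
  "approx_tr_solution q A r p \<longleftrightarrow>
     norm p \<le> r \<and>
     (\<exists>c. is_cauchy_point q A r c \<and> model q A 0 - model q A c \<le> model q A 0 - model q A p)"

definition batches :: "nat \<Rightarrow> nat \<Rightarrow> nat set set" where
  "batches N b = {J. J \<subseteq> {1..N} \<and> card J = b}"

text \<open>The \<open>\<sigma>\<close>-algebra of everything determined before the mini-batch \<open>I k s\<close> is drawn: all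
  iterates up to and including \<open>x k s\<close>, and all earlier mini-batches.\<close>

definition history ::
  "'w measure \<Rightarrow> nat \<Rightarrow> (nat \<Rightarrow> nat \<Rightarrow> 'w \<Rightarrow> 'a::topological_space) \<Rightarrow>
   (nat \<Rightarrow> nat \<Rightarrow> 'w \<Rightarrow> nat set) \<Rightarrow> nat \<Rightarrow> nat \<Rightarrow> 'w measure" where
  "history M S x I k s = sigma (space M)
     ({x k' s' -` B \<inter> space M | k' s' B.
         s' \<le> S \<and> (k' < k \<or> k' = k \<and> s' \<le> s) \<and> B \<in> sets borel} \<union>
      {I k' s' -` \<J> \<inter> space M | k' s' \<J>.
         s' < S \<and> (k' < k \<or> k' = k \<and> s' < s)})"

text \<open>A run of TRSVR on a probability space. A mini-batch is a uniformly distributed \<open>b\<close>-element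
  subset of \<open>{1..N}\<close>, drawn independently of the past. (Unbiasedness of the mini-batch gradient on
  its own, without uniform sampling, does not yield the \<open>1/b\<close> variance reduction on which the
  complexity bound rests.) The matrices \<open>H k s\<close> are arbitrary functions of the sample
  point, so they may depend on the current mini-batch and on further randomness.\<close>

locale trsvr = prob_space M
  for M :: "'w measure" +
  fixes N b S :: nat
    and \<alpha> :: real
    and f :: "nat \<Rightarrow> real^'d \<Rightarrow> real"
    and x :: "nat \<Rightarrow> nat \<Rightarrow> 'w \<Rightarrow> real^'d"
    and I :: "nat \<Rightarrow> nat \<Rightarrow> 'w \<Rightarrow> nat set"
    and H :: "nat \<Rightarrow> nat \<Rightarrow> 'w \<Rightarrow> real^'d^'d"
  assumes batch_size: "1 \<le> b" "b \<le> N"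
    and inner_length_pos: "0 < S"
    and radius_control_pos: "0 < \<alpha>"
    and iterate_measurable: "\<And>k s. s \<le> S \<Longrightarrow> x k s \<in> borel_measurable M"
    and batch_measurable: "\<And>k s. s < S \<Longrightarrow> I k s \<in> M \<rightarrow>\<^sub>M count_space (batches N b)"
    and batch_uniform: "\<And>k s. s < S \<Longrightarrow>
      distr M (count_space (batches N b)) (I k s) = uniform_count_measure (batches N b)"
    and batch_indep: "\<And>k s. s < S \<Longrightarrow>
      indep_set (sets (history M S x I k s))
        (sets (vimage_algebra (space M) (I k s) (count_space (batches N b))))"
    and inner_step: "\<And>k s \<omega>. s < S \<Longrightarrow> \<omega> \<in> space M \<Longrightarrow>
      (let q = vr_gradient N b f (I k s \<omega>) (x k s \<omega>) (x k 0 \<omega>)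
       in \<exists>p. approx_tr_solution q (H k s \<omega>) (\<alpha> * norm q) p \<and> x k (Suc s) \<omega> = x k s \<omega> + p)"
    and outer_step: "\<And>k \<omega>. \<omega> \<in> space M \<Longrightarrow> x (Suc k) 0 \<omega> = x k S \<omega>"

text \<open>The matrix norm is the operator norm; the library's \<open>norm\<close> on matrices is the Frobenius norm.\<close>

definition regularity ::
  "'w measure \<Rightarrow> nat \<Rightarrow> nat \<Rightarrow> real \<Rightarrow> real \<Rightarrow> real \<Rightarrow> (real^'d) set \<Rightarrow> (nat \<Rightarrow> real^'d \<Rightarrow> real) \<Rightarrow>
   (nat \<Rightarrow> nat \<Rightarrow> 'w \<Rightarrow> real^'d) \<Rightarrow> (nat \<Rightarrow> nat \<Rightarrow> 'w \<Rightarrow> real^'d^'d) \<Rightarrow> bool" where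
  "regularity M N S L \<kappa>\<^sub>H f_inf X f x H \<longleftrightarrow>
     open X \<and> convex X \<and>
     (\<forall>k s. \<forall>\<omega>\<in>space M. s \<le> S \<longrightarrow> x k s \<omega> \<in> X) \<and>
     (\<forall>y. f_inf \<le> avg N f y) \<and>
     (\<forall>i\<in>{1..N}. (\<forall>y. f i differentiable (at y)) \<and> continuous_on UNIV (gradient (f i)) \<and>
        L-lipschitz_on UNIV (gradient (f i))) \<and>
     (\<forall>k s. \<forall>\<omega>\<in>space M. s < S \<longrightarrow> onorm (\<lambda>v. H k s \<omega> *v v) \<le> \<kappa>\<^sub>H)"

text \<open>Conditional expectation of a random vector given \<open>x k s\<close>, taken componentwise.\<close>

definition unbiased ::
  "'w measure \<Rightarrow> nat \<Rightarrow> nat \<Rightarrow> nat \<Rightarrow> (nat \<Rightarrow> real^'d \<Rightarrow> real) \<Rightarrow>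
   (nat \<Rightarrow> nat \<Rightarrow> 'w \<Rightarrow> real^'d) \<Rightarrow> (nat \<Rightarrow> nat \<Rightarrow> 'w \<Rightarrow> nat set) \<Rightarrow> bool" where
  "unbiased M N b S f x I \<longleftrightarrow>
     (\<forall>k s j. s < S \<longrightarrow>
        (AE \<omega> in M.
           real_cond_exp M (vimage_algebra (space M) (x k s) borel)
             (\<lambda>\<omega>. minibatch_gradient b f (I k s \<omega>) (x k s \<omega>) $ j) \<omega>
           = gradient (avg N f) (x k s \<omega>) $ j))"

end

theory Submission
  imports Defs
begin

text \<open>The trust-region radius is \<open>\<alpha> \<parallel>q\<parallel>\<close>, where \<open>q\<close> is the variance-reduced gradient, and with the prescribed
  parameters \<open>\<alpha> = \<mu>0 \<mu>1 / (2 (L + 2 \<kappa>\<^sub>H))\<close> depends on neither \<open>N\<close> nor the run and is small with \<open>\<mu>0\<close>. The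
  quadratic term of the model is then a small perturbation, and a feasible step that is no worse
  than the Cauchy point must be close to \<open>- \<alpha> q\<close> (\<open>trust_region_step\<close>). So the method is a
  stochastic gradient method with step size \<open>\<alpha>\<close>, up to relative errors bounded by a small number \<open>\<delta>\<close>,
  even if the Hessian approximations depend on the current batch.

  Write \<open>g\<close> for the full gradient. Since the batch is uniform and independent of the past,
  \<open>q\<close> has conditional mean \<open>g\<close>, so the leading term of the descent inequality is \<open>- \<alpha> E \<parallel>g\<parallel>\<^sup>2\<close>, while
  \<open>E \<parallel>q\<parallel>\<^sup>2\<close> occurs only with the factor \<open>\<alpha> \<delta>\<close> (\<open>mean_F_step\<close>). It remains to bound the sum of
  \<open>E \<parallel>q\<parallel>\<^sup>2\<close> over an epoch by a constant times the sum of \<open>E \<parallel>g\<parallel>\<^sup>2\<close>; the constant may be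
  large, but must not depend on \<open>\<mu>0\<close>, since \<open>\<delta>\<close> has to beat it.

  The variance of \<open>q\<close> is at most \<open>L\<^sup>2 / b\<close> times the squared distance from the reference point
  (\<open>batch_mean_variance\<close>), and that distance is a sum of at most \<open>S\<close> steps of length at most \<open>\<alpha> \<parallel>q\<parallel>\<close>. So
  \<open>E \<parallel>q\<parallel>\<^sup>2\<close> at step \<open>s\<close> is at most \<open>E \<parallel>g\<parallel>\<^sup>2\<close> plus \<open>a / S\<close> times the sum of its earlier values, with
  \<open>a = L\<^sup>2 \<alpha>\<^sup>2 S\<^sup>2 / b\<close>, and the discrete Gronwall inequality yields the constant \<open>exp a\<close>
  (\<open>sum_mean_q2_le\<close>). The bound on \<open>S\<close> gives \<open>a \<le> 1 / (4 \<mu>1)\<close> whatever \<open>\<mu>0\<close> is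
  (\<open>step_budget_le\<close>). With \<open>\<delta> = exp (- 1 / (4 \<mu>1)) / 4\<close> every epoch lowers the expected
  objective by at least half of the leading term, and the epochs telescope.\<close>

section \<open>Gradients and the descent inequality\<close>

lemma gradient_eqI:
  fixes h :: "'a::euclidean_space \<Rightarrow> real"
  assumes "GDERIV h y :> D"
  shows "gradient h y = D"
proof -
  have "D' = D" if "GDERIV h y :> D'" for D'
  proof -
    have "(\<lambda>v. v \<bullet> D') = (\<lambda>v. v \<bullet> D)"
      using that assms unfolding gderiv_def by (rule has_derivative_unique)
    then have "v \<bullet> D' = v \<bullet> D" for v by (rule fun_cong)
    then show ?thesis by (metis euclidean_eq_iff inner_commute)
  qed
  with assms show ?thesis unfolding gradient_def by (intro the_equality)
qed

text \<open>The coordinates of the gradient are the values of the Frechet derivative on the basis vectors.\<close>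

lemma GDERIV_gradient:
  fixes h :: "'a::euclidean_space \<Rightarrow> real"
  assumes "h differentiable (at y)"
  shows "GDERIV h y :> gradient h y"
proof -
  obtain h' where h': "(h has_derivative h') (at y)"
    using assms unfolding differentiable_def by blast
  interpret h': bounded_linear h' using h' by (rule has_derivative_bounded_linear)
  have h'_eq: "h' = (\<lambda>v. v \<bullet> (\<Sum>e\<in>Basis. h' e *\<^sub>R e))"
  proof
    fix v
    have "h' v = h' (\<Sum>e\<in>Basis. (v \<bullet> e) *\<^sub>R e)" by (simp add: euclidean_representation)
    also have "\<dots> = (\<Sum>e\<in>Basis. (v \<bullet> e) * h' e)" by (simp add: h'.sum h'.scaleR)
    also have "\<dots> = v \<bullet> (\<Sum>e\<in>Basis. h' e *\<^sub>R e)" by (simp add: inner_sum_right mult.commute)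
    finally show "h' v = v \<bullet> (\<Sum>e\<in>Basis. h' e *\<^sub>R e)" .
  qed
  have D: "GDERIV h y :> (\<Sum>e\<in>Basis. h' e *\<^sub>R e)"
    unfolding gderiv_def by (rule back_subst[of "\<lambda>D. (h has_derivative D) (at y)", OF h' h'_eq])
  show ?thesis unfolding gradient_eqI[OF D] by (rule D)
qed

lemma GDERIV_avg:
  fixes f :: "nat \<Rightarrow> 'a::euclidean_space \<Rightarrow> real"
  assumes "\<And>i. i \<in> {1..N} \<Longrightarrow> f i differentiable (at y)"
  shows "GDERIV (avg N f) y :> (1 / real N) *\<^sub>R (\<Sum>i=1..N. gradient (f i) y)"
proof -
  have "(f i has_derivative (\<lambda>v. v \<bullet> gradient (f i) y)) (at y)" if "i \<in> {1..N}" for i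
    using GDERIV_gradient[OF assms[OF that]] by (simp add: gderiv_def)
  then have "((\<lambda>y. (1 / real N) * (\<Sum>i=1..N. f i y)) has_derivative
      (\<lambda>v. (1 / real N) * (\<Sum>i=1..N. v \<bullet> gradient (f i) y))) (at y)"
    by (intro has_derivative_mult_right has_derivative_sum) auto
  then show ?thesis
    unfolding gderiv_def avg_def by (simp add: inner_sum_right)
qed

text \<open>The usual quadratic upper bound for a function with Lipschitz gradient. The function \<open>\<phi>\<close> in the
  proof is the gap along the segment from \<open>y\<close> to \<open>y + p\<close>; its slope is nonpositive because the
  gradient turns by at most \<open>L t \<parallel>p\<parallel>\<close> within time \<open>t\<close>.\<close>

lemma descent_inequality:
  fixes h :: "'a::euclidean_space \<Rightarrow> real"
  assumes diff: "\<And>y. h differentiable (at y)" and lip: "L-lipschitz_on UNIV (gradient h)"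
  shows "h (y + p) \<le> h y + gradient h y \<bullet> p + L / 2 * (norm p)\<^sup>2"
proof -
  define \<phi> where "\<phi> t = h (y + t *\<^sub>R p) - t * (gradient h y \<bullet> p) - L / 2 * t\<^sup>2 * (norm p)\<^sup>2" for t :: real
  have "\<phi> 1 \<le> \<phi> 0"
  proof (rule DERIV_nonpos_imp_nonincreasing[of 0 1 \<phi>])
    fix t :: real assume t: "0 \<le> t" "t \<le> 1"
    have h: "(h has_derivative (\<lambda>v. v \<bullet> gradient h (y + t *\<^sub>R p))) (at (y + t *\<^sub>R p))"
      using GDERIV_gradient[OF diff] by (simp add: gderiv_def)
    have l: "((\<lambda>t. y + t *\<^sub>R p) has_derivative (\<lambda>d. d *\<^sub>R p)) (at t)"
      by (auto intro!: derivative_eq_intros)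
    have "((\<lambda>t. h (y + t *\<^sub>R p)) has_derivative (\<lambda>d. (d *\<^sub>R p) \<bullet> gradient h (y + t *\<^sub>R p))) (at t)"
      using has_derivative_compose[OF l h] .
    then have d: "((\<lambda>t. h (y + t *\<^sub>R p)) has_real_derivative (p \<bullet> gradient h (y + t *\<^sub>R p))) (at t)"
      unfolding has_field_derivative_def
      by (rule back_subst[where P = "\<lambda>D. (_ has_derivative D) (at t)"]) (auto simp: mult.commute)
    have "(\<phi> has_real_derivative
        (p \<bullet> gradient h (y + t *\<^sub>R p) - gradient h y \<bullet> p - L * t * (norm p)\<^sup>2)) (at t)"
      unfolding \<phi>_def by (rule derivative_eq_intros d refl | simp)+
    moreover have "p \<bullet> gradient h (y + t *\<^sub>R p) - gradient h y \<bullet> p \<le> L * t * (norm p)\<^sup>2"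
    proof -
      have "p \<bullet> gradient h (y + t *\<^sub>R p) - gradient h y \<bullet> p
          = p \<bullet> (gradient h (y + t *\<^sub>R p) - gradient h y)"
        by (simp add: inner_diff_right inner_commute)
      also have "\<dots> \<le> norm p * norm (gradient h (y + t *\<^sub>R p) - gradient h y)"
        by (rule norm_cauchy_schwarz)
      also have "\<dots> \<le> norm p * (L * norm (t *\<^sub>R p))"
        using lipschitz_onD[OF lip, of "y + t *\<^sub>R p" y] by (intro mult_left_mono) (auto simp: dist_norm)
      finally show ?thesis using t by (simp add: power2_eq_square mult_ac)
    qed
    ultimately show "\<exists>D. (\<phi> has_real_derivative D) (at t) \<and> D \<le> 0" by fastforce
  qed simp
  then show ?thesis by (simp add: \<phi>_def)
qed

text \<open>A gradient step of length \<open>1/L'\<close> already lowers \<open>h\<close> by \<open>\<parallel>\<nabla>h\<parallel>\<^sup>2 / (2 L')\<close>, and it cannot go below \<open>m\<close>.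
  This turns integrability of function values into square-integrability of gradients. The strict
  inequality \<open>L < L'\<close> makes \<open>L'\<close> positive also when \<open>L = 0\<close>.\<close>

lemma norm_gradient_le_gap:
  fixes h :: "'a::euclidean_space \<Rightarrow> real"
  assumes diff: "\<And>y. h differentiable (at y)" and lip: "L-lipschitz_on UNIV (gradient h)"
    and below: "\<And>y. m \<le> h y" and "L < L'"
  shows "(norm (gradient h y))\<^sup>2 \<le> 2 * L' * (h y - m)"
proof -
  have pos: "0 < L'" using lipschitz_on_nonneg[OF lip] assms(4) by linarith
  let ?g = "gradient h y" and ?p = "- ((1 / L') *\<^sub>R gradient h y)"
  have "m \<le> h (y + ?p)" by (rule below)
  also have "\<dots> \<le> h y + ?g \<bullet> ?p + L / 2 * (norm ?p)\<^sup>2"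
    by (rule descent_inequality[OF diff lip])
  also have "\<dots> \<le> h y + ?g \<bullet> ?p + L' / 2 * (norm ?p)\<^sup>2"
    using assms(4) by (intro add_left_mono mult_right_mono) auto
  also have "\<dots> = h y - (norm ?g)\<^sup>2 / (2 * L')"
    using pos by (simp add: power2_norm_eq_inner[symmetric] field_simps power2_eq_square[of L'])
  finally show ?thesis using pos by (simp add: field_simps)
qed

section \<open>Sampling without replacement\<close>

lemma card_subsets_containing:
  assumes A: "finite A" and T: "T \<subseteq> A" "card T \<le> b"
  shows "card {J. J \<subseteq> A \<and> card J = b \<and> T \<subseteq> J} = (card A - card T) choose (b - card T)"
proof -
  have fT: "finite T" using A T finite_subset by blast
  have "bij_betw (\<lambda>K. K \<union> T) {K. K \<subseteq> A - T \<and> card K = b - card T}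
      {J. J \<subseteq> A \<and> card J = b \<and> T \<subseteq> J}"
  proof (rule bij_betwI[where g = "\<lambda>J. J - T"], goal_cases)
    case 1
    show ?case
    proof
      fix K assume "K \<in> {K. K \<subseteq> A - T \<and> card K = b - card T}"
      then have K: "K \<subseteq> A - T" "card K = b - card T" by auto
      have "finite K" using K A finite_subset by blast
      then have "card (K \<union> T) = card K + card T" using fT K by (intro card_Un_disjoint) auto
      then show "K \<union> T \<in> {J. J \<subseteq> A \<and> card J = b \<and> T \<subseteq> J}" using K T by auto
    qed
  next
    case 2
    show ?case using fT by (auto simp: card_Diff_subset)
  qed auto
  then have "card {J. J \<subseteq> A \<and> card J = b \<and> T \<subseteq> J} = card {K. K \<subseteq> A - T \<and> card K = b - card T}"
    by (simp add: bij_betw_same_card)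
  also have "\<dots> = (card A - card T) choose (b - card T)"
    using n_subsets[of "A - T" "b - card T"] A T fT by (simp add: card_Diff_subset)
  finally show ?thesis .
qed

lemma finite_batches: "finite (batches N b)"
  unfolding batches_def by (rule finite_subset[of _ "Pow {1..N}"]) auto

lemma card_batches: "card (batches N b) = N choose b"
  unfolding batches_def using n_subsets[of "{1..N}" b] by simp

lemma card_batches_containing:
  assumes "i \<in> {1..N}" "1 \<le> b"
  shows "card {J \<in> batches N b. i \<in> J} = (N - 1) choose (b - 1)"
  using card_subsets_containing[of "{1..N}" "{i}" b] assms by (simp add: batches_def conj_ac)

lemma card_batches_containing_two:
  assumes "i \<in> {1..N}" "j \<in> {1..N}" "i \<noteq> j"
  shows "card {J \<in> batches N b. i \<in> J \<and> j \<in> J} = (if 2 \<le> b then (N - 2) choose (b - 2) else 0)"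
proof (cases "2 \<le> b")
  case True
  then show ?thesis
    using card_subsets_containing[of "{1..N}" "{i, j}" b] assms by (simp add: batches_def conj_ac numeral_2_eq_2)
next
  case False
  have none: "{J \<in> batches N b. i \<in> J \<and> j \<in> J} = {}"
  proof (rule ccontr)
    assume "\<not> ?thesis"
    then obtain J where J: "J \<subseteq> {1..N}" "card J = b" "{i, j} \<subseteq> J" by (auto simp: batches_def)
    have "card {i, j} \<le> card J" using J finite_subset by (intro card_mono) auto
    then show False using J False assms by simp
  qed
  show ?thesis unfolding none using False by simp
qed

lemma sum_batches_sum:
  fixes v :: "nat \<Rightarrow> 'a::real_vector"
  assumes "1 \<le> b"
  shows "(\<Sum>J\<in>batches N b. \<Sum>i\<in>J. v i) = real ((N - 1) choose (b - 1)) *\<^sub>R (\<Sum>i=1..N. v i)"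
proof -
  have "(\<Sum>J\<in>batches N b. \<Sum>i\<in>J. v i) = (\<Sum>J\<in>batches N b. \<Sum>i | i \<in> {1..N} \<and> i \<in> J. v i)"
    by (intro sum.cong refl) (auto simp: batches_def)
  also have "\<dots> = (\<Sum>i=1..N. \<Sum>J | J \<in> batches N b \<and> i \<in> J. v i)"
    by (rule sum.swap_restrict[OF finite_batches]) simp
  also have "\<dots> = (\<Sum>i=1..N. real ((N - 1) choose (b - 1)) *\<^sub>R v i)"
    using card_batches_containing[OF _ assms] by (intro sum.cong refl) (auto simp: scaleR_conv_of_real sum_constant_scaleR)
  finally show ?thesis by (simp add: scaleR_sum_right)
qed

lemma batch_ratio:
  assumes "1 \<le> b" "b \<le> N"
  shows "real ((N - 1) choose (b - 1)) = real b / real N * real (N choose b)"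
proof -
  have "b * (N choose b) = N * ((N - 1) choose (b - 1))"
    using assms by (intro times_binomial_minus1_eq) simp
  then have "real b * real (N choose b) = real N * real ((N - 1) choose (b - 1))"
    by (metis of_nat_mult)
  then show ?thesis using assms by (simp add: field_simps)
qed

text \<open>Expanding the square and exchanging sums, \<open>u\<^sub>i \<bullet> u\<^sub>j\<close> is counted once for each batch that
  contains both indices: \<open>c1\<close> times on the diagonal and \<open>c2\<close> times off it. The full double sum
  vanishes by centring, which leaves \<open>(c1 - c2) \<Sum> \<parallel>u\<^sub>i\<parallel>\<^sup>2\<close>.\<close>

lemma sum_batches_centred:
  fixes u :: "nat \<Rightarrow> 'a::real_inner"
  assumes b: "1 \<le> b" and centred: "(\<Sum>i=1..N. u i) = 0"
  shows "(\<Sum>J\<in>batches N b. (norm (\<Sum>i\<in>J. u i))\<^sup>2)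
           \<le> real ((N - 1) choose (b - 1)) * (\<Sum>i=1..N. (norm (u i))\<^sup>2)"
proof -
  define c1 where "c1 = real ((N - 1) choose (b - 1))"
  define c2 where "c2 = real (if 2 \<le> b then (N - 2) choose (b - 2) else 0)"
  have c2: "0 \<le> c2" by (simp add: c2_def)
  have "(\<Sum>J\<in>batches N b. (norm (\<Sum>i\<in>J. u i))\<^sup>2)
      = (\<Sum>J\<in>batches N b. \<Sum>i | i \<in> {1..N} \<and> i \<in> J. \<Sum>j | j \<in> {1..N} \<and> j \<in> J. u i \<bullet> u j)"
  proof (intro sum.cong refl)
    fix J assume "J \<in> batches N b"
    then have "{i. i \<in> {1..N} \<and> i \<in> J} = J" by (auto simp: batches_def)
    then show "(norm (\<Sum>i\<in>J. u i))\<^sup>2 =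
        (\<Sum>i | i \<in> {1..N} \<and> i \<in> J. \<Sum>j | j \<in> {1..N} \<and> j \<in> J. u i \<bullet> u j)"
      by (simp only: power2_norm_eq_inner inner_sum_left) (simp add: inner_sum_right)
  qed
  also have "\<dots> = (\<Sum>i=1..N. \<Sum>J | J \<in> batches N b \<and> i \<in> J. \<Sum>j | j \<in> {1..N} \<and> j \<in> J. u i \<bullet> u j)"
    by (rule sum.swap_restrict[OF finite_batches]) simp
  also have "\<dots> = (\<Sum>i=1..N. \<Sum>j=1..N. \<Sum>J | J \<in> {J \<in> batches N b. i \<in> J} \<and> j \<in> J. u i \<bullet> u j)"
    using finite_batches by (intro sum.cong refl) (subst sum.swap_restrict, auto)
  also have "\<dots> = (\<Sum>i=1..N. \<Sum>j=1..N. (if j = i then (c1 - c2) * (u i \<bullet> u i) else 0) + c2 * (u i \<bullet> u j))"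
  proof (intro sum.cong refl)
    fix i j assume ij: "i \<in> {1..N}" "j \<in> {1..N}"
    have "(\<Sum>J | J \<in> {J \<in> batches N b. i \<in> J} \<and> j \<in> J. u i \<bullet> u j)
        = real (card {J \<in> batches N b. i \<in> J \<and> j \<in> J}) * (u i \<bullet> u j)"
      by (simp add: conj_ac)
    also have "\<dots> = (if j = i then (c1 - c2) * (u i \<bullet> u i) else 0) + c2 * (u i \<bullet> u j)"
    proof (cases "j = i")
      case True
      then show ?thesis using card_batches_containing[OF ij(1) b] by (simp add: c1_def algebra_simps)
    next
      case False
      then show ?thesis using card_batches_containing_two[OF ij, of b] by (simp add: c2_def)
    qed
    finally show "(\<Sum>J | J \<in> {J \<in> batches N b. i \<in> J} \<and> j \<in> J. u i \<bullet> u j)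
      = (if j = i then (c1 - c2) * (u i \<bullet> u i) else 0) + c2 * (u i \<bullet> u j)" .
  qed
  also have "\<dots> = (c1 - c2) * (\<Sum>i=1..N. u i \<bullet> u i) + c2 * ((\<Sum>i=1..N. u i) \<bullet> (\<Sum>j=1..N. u j))"
    by (simp only: inner_sum_left) (simp add: sum.distrib sum_distrib_left inner_sum_right)
  also have "\<dots> = (c1 - c2) * (\<Sum>i=1..N. (norm (u i))\<^sup>2)"
    using centred by (simp add: power2_norm_eq_inner)
  also have "\<dots> \<le> c1 * (\<Sum>i=1..N. (norm (u i))\<^sup>2)"
    using c2 by (intro mult_right_mono sum_nonneg) auto
  finally show ?thesis by (simp add: c1_def)
qed

lemma sum_centred_square_le:
  fixes v :: "nat \<Rightarrow> 'a::real_inner"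
  assumes "0 < N" and m: "m = (1 / real N) *\<^sub>R (\<Sum>i=1..N. v i)"
  shows "(\<Sum>i=1..N. (norm (v i - m))\<^sup>2) \<le> (\<Sum>i=1..N. (norm (v i))\<^sup>2)"
proof -
  have s: "(\<Sum>i=1..N. v i) = real N *\<^sub>R m" using assms by simp
  have "(\<Sum>i=1..N. (norm (v i - m))\<^sup>2) = (\<Sum>i=1..N. (norm (v i))\<^sup>2 - 2 * (v i \<bullet> m) + m \<bullet> m)"
    by (intro sum.cong refl) (simp add: power2_norm_eq_inner algebra_simps inner_commute)
  also have "\<dots> = (\<Sum>i=1..N. (norm (v i))\<^sup>2) - 2 * ((\<Sum>i=1..N. v i) \<bullet> m) + real N * (m \<bullet> m)"
    by (simp add: sum.distrib sum_subtractf sum_distrib_left inner_sum_left)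
  also have "\<dots> = (\<Sum>i=1..N. (norm (v i))\<^sup>2) - real N * (m \<bullet> m)" unfolding s by simp
  finally show ?thesis by simp
qed

text \<open>The factor \<open>1/b\<close> here is the variance reduction by mini-batches. It comes from the centred bound,
  since an index lies in the fraction \<open>b/N\<close> of all batches.\<close>

lemma batch_mean_variance:
  fixes v :: "nat \<Rightarrow> 'a::real_inner"
  assumes b: "1 \<le> b" "b \<le> N" and m: "m = (1 / real N) *\<^sub>R (\<Sum>i=1..N. v i)"
  shows "(\<Sum>J\<in>batches N b. (norm ((1 / real b) *\<^sub>R (\<Sum>i\<in>J. v i) - m))\<^sup>2)
           \<le> real (card (batches N b)) / (real b * real N) * (\<Sum>i=1..N. (norm (v i))\<^sup>2)"
proof -
  have Npos: "0 < N" using b by simp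
  have centred: "(\<Sum>i=1..N. v i - m) = 0" using Npos by (simp add: sum_subtractf sum_constant_scaleR m del: sum_constant)
  have "(\<Sum>J\<in>batches N b. (norm ((1 / real b) *\<^sub>R (\<Sum>i\<in>J. v i) - m))\<^sup>2)
      = (\<Sum>J\<in>batches N b. 1 / (real b)\<^sup>2 * (norm (\<Sum>i\<in>J. v i - m))\<^sup>2)"
  proof (intro sum.cong refl)
    fix J assume "J \<in> batches N b"
    then have "card J = b" by (simp add: batches_def)
    then have "(1 / real b) *\<^sub>R (\<Sum>i\<in>J. v i) - m = (1 / real b) *\<^sub>R (\<Sum>i\<in>J. v i - m)"
      using b by (simp add: sum_subtractf scaleR_diff_right sum_constant_scaleR)
    then show "(norm ((1 / real b) *\<^sub>R (\<Sum>i\<in>J. v i) - m))\<^sup>2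
        = 1 / (real b)\<^sup>2 * (norm (\<Sum>i\<in>J. v i - m))\<^sup>2"
      by (simp add: power_divide)
  qed
  also have "\<dots> = 1 / (real b)\<^sup>2 * (\<Sum>J\<in>batches N b. (norm (\<Sum>i\<in>J. v i - m))\<^sup>2)"
    by (simp only: sum_distrib_left)
  also have "\<dots> \<le> 1 / (real b)\<^sup>2 * (real ((N - 1) choose (b - 1)) * (\<Sum>i=1..N. (norm (v i - m))\<^sup>2))"
    by (intro mult_left_mono sum_batches_centred b centred) auto
  also have "\<dots> \<le> 1 / (real b)\<^sup>2 * (real ((N - 1) choose (b - 1)) * (\<Sum>i=1..N. (norm (v i))\<^sup>2))"
    by (intro mult_left_mono sum_centred_square_le Npos m) auto
  also have "\<dots> = real (card (batches N b)) / (real b * real N) * (\<Sum>i=1..N. (norm (v i))\<^sup>2)"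
    unfolding batch_ratio[OF b] card_batches using b by (simp add: power2_eq_square)
  finally show ?thesis .
qed

section \<open>One trust-region step and a discrete Gronwall inequality\<close>

text \<open>The vector \<open>- \<alpha> q\<close> competes with the Cauchy point, so the model value at \<open>p\<close> is at most its value
  at \<open>- \<alpha> q\<close>. As the quadratic terms are of size \<open>\<kappa> \<alpha>\<^sup>2 \<parallel>q\<parallel>\<^sup>2\<close>, the linear term \<open>q \<bullet> p\<close> is close to its minimum
  \<open>- \<alpha> \<parallel>q\<parallel>\<^sup>2\<close> on the ball of radius \<open>\<alpha> \<parallel>q\<parallel>\<close>, which forces \<open>p\<close> close to \<open>- \<alpha> q\<close>. The relative deviation is of
  order \<open>sqrt (\<kappa> \<alpha>)\<close>; it may be correlated with the sampling noise, so only its size is used.\<close>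

lemma trust_region_step:
  assumes sol: "approx_tr_solution q A (\<alpha> * norm q) p" and A: "onorm (\<lambda>v. A *v v) \<le> \<kappa>" and \<alpha>: "0 < \<alpha>"
  shows "norm p \<le> \<alpha> * norm q" "(norm (p + \<alpha> *\<^sub>R q))\<^sup>2 \<le> 2 * \<kappa> * \<alpha>^3 * (norm q)\<^sup>2"
proof -
  show np: "norm p \<le> \<alpha> * norm q" using sol by (simp add: approx_tr_solution_def)
  have quad: "\<bar>v \<bullet> (A *v v)\<bar> \<le> \<kappa> * (norm v)\<^sup>2" for v
  proof -
    have "\<bar>v \<bullet> (A *v v)\<bar> \<le> norm v * norm (A *v v)" by (rule Cauchy_Schwarz_ineq2)
    also have "\<dots> \<le> norm v * (\<kappa> * norm v)"
      using onorm[OF matrix_vector_mul_bounded_linear, of A v] mult_right_mono[OF A norm_ge_zero[of v]]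
      by (intro mult_left_mono) auto
    finally show ?thesis by (simp add: power2_eq_square mult_ac)
  qed
  have \<kappa>: "0 \<le> \<kappa>" using A onorm_pos_le[OF matrix_vector_mul_bounded_linear, of A] by linarith
  obtain c where c: "is_cauchy_point q A (\<alpha> * norm q) c" "model q A p \<le> model q A c"
    using sol by (auto simp: approx_tr_solution_def)
  have "model q A c \<le> model q A (- (\<alpha> *\<^sub>R q))"
    using c(1) \<alpha> unfolding is_cauchy_point_def is_arg_min_linorder
    by (auto dest!: spec[of _ "- (\<alpha> *\<^sub>R q)"] intro!: exI[of _ \<alpha>])
  with c(2) have "model q A p \<le> model q A (- (\<alpha> *\<^sub>R q))" by linarith
  moreover have "model q A (- (\<alpha> *\<^sub>R q)) \<le> - \<alpha> * (norm q)\<^sup>2 + \<kappa> / 2 * \<alpha>\<^sup>2 * (norm q)\<^sup>2"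
  proof -
    have "A *v (- (\<alpha> *\<^sub>R q)) = - (\<alpha> *\<^sub>R (A *v q))"
      by (simp add: linear_neg linear_cmul)
    then have "model q A (- (\<alpha> *\<^sub>R q)) = - \<alpha> * (norm q)\<^sup>2 + \<alpha>\<^sup>2 * (q \<bullet> (A *v q)) / 2"
      by (simp add: model_def power2_norm_eq_inner power2_eq_square[of \<alpha>] mult.assoc)
    moreover have "\<alpha>\<^sup>2 * (q \<bullet> (A *v q)) \<le> \<alpha>\<^sup>2 * (\<kappa> * (norm q)\<^sup>2)"
      using quad[of q] by (intro mult_left_mono) auto
    ultimately show ?thesis by (simp add: mult_ac)
  qed
  moreover have "q \<bullet> p - \<kappa> / 2 * \<alpha>\<^sup>2 * (norm q)\<^sup>2 \<le> model q A p"
  proof -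
    have "(norm p)\<^sup>2 \<le> (\<alpha> * norm q)\<^sup>2" using np by (intro power_mono) auto
    then have "\<kappa> * (norm p)\<^sup>2 \<le> \<kappa> * (\<alpha> * norm q)\<^sup>2" using \<kappa> by (intro mult_left_mono)
    then show ?thesis using quad[of p] unfolding model_def power_mult_distrib by (simp add: abs_le_iff)
  qed
  ultimately have qp: "q \<bullet> p \<le> - \<alpha> * (norm q)\<^sup>2 + \<kappa> * \<alpha>\<^sup>2 * (norm q)\<^sup>2" by (simp add: field_simps)
  have "(norm (p + \<alpha> *\<^sub>R q))\<^sup>2 = (norm p)\<^sup>2 + 2 * \<alpha> * (q \<bullet> p) + \<alpha>\<^sup>2 * (norm q)\<^sup>2"
    by (simp add: power2_norm_eq_inner algebra_simps inner_commute power2_eq_square[of \<alpha>])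
  also have "\<dots> \<le> (\<alpha> * norm q)\<^sup>2 + 2 * \<alpha> * (- \<alpha> * (norm q)\<^sup>2 + \<kappa> * \<alpha>\<^sup>2 * (norm q)\<^sup>2) + \<alpha>\<^sup>2 * (norm q)\<^sup>2"
    using np qp \<alpha> by (intro add_mono power_mono mult_left_mono) auto
  also have "\<dots> = 2 * \<kappa> * \<alpha>^3 * (norm q)\<^sup>2" by (simp add: power_mult_distrib algebra_simps power2_eq_square power3_eq_cube)
  finally show "(norm (p + \<alpha> *\<^sub>R q))\<^sup>2 \<le> 2 * \<kappa> * \<alpha>^3 * (norm q)\<^sup>2" .
qed

text \<open>The partial sums \<open>P\<close> of \<open>Q\<close> satisfy \<open>P (s + 1) \<le> (1 + a) P s + G s\<close>, so each \<open>G s\<close> is amplified at most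
  \<open>n\<close> times by the factor \<open>1 + a\<close>.\<close>

lemma sum_gronwall:
  fixes G Q :: "nat \<Rightarrow> real"
  assumes a: "0 \<le> a" and G: "\<And>s. s < n \<Longrightarrow> 0 \<le> G s"
    and step: "\<And>s. s < n \<Longrightarrow> Q s \<le> G s + a * (\<Sum>j<s. Q j)"
  shows "(\<Sum>s<n. Q s) \<le> (1 + a) ^ n * (\<Sum>s<n. G s)"
  using G step
proof (induction n)
  case (Suc n)
  have IH: "(\<Sum>s<n. Q s) \<le> (1 + a) ^ n * (\<Sum>s<n. G s)" using Suc by simp
  have "(\<Sum>s<Suc n. Q s) \<le> G n + (1 + a) * (\<Sum>s<n. Q s)"
    using Suc.prems(2)[of n] by (simp add: algebra_simps)
  also have "\<dots> \<le> (1 + a) ^ Suc n * G n + (1 + a) * ((1 + a) ^ n * (\<Sum>s<n. G s))"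
  proof (intro add_mono mult_left_mono IH)
    have "1 * G n \<le> (1 + a) ^ Suc n * G n"
      using a Suc.prems(1)[of n] by (intro mult_right_mono one_le_power) auto
    then show "G n \<le> (1 + a) ^ Suc n * G n" by simp
  qed (use a in simp)
  also have "\<dots> = (1 + a) ^ Suc n * (\<Sum>s<Suc n. G s)" by (simp add: algebra_simps)
  finally show ?case .
qed simp

lemma norm_sum_square_le:
  fixes v :: "nat \<Rightarrow> 'a::real_normed_vector"
  shows "(norm (\<Sum>j<s. v j))\<^sup>2 \<le> real s * (\<Sum>j<s. (norm (v j))\<^sup>2)"
proof -
  have "(norm (\<Sum>j<s. v j))\<^sup>2 \<le> (\<Sum>j<s. norm (v j))\<^sup>2"
    by (intro power_mono norm_sum) simp
  also have "\<dots> \<le> real s * (\<Sum>j<s. (norm (v j))\<^sup>2)"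
    using sum_squared_le_sum_of_squares[of "\<lambda>j. norm (v j)" "{..<s}"] by (simp add: mult.commute)
  finally show ?thesis .
qed

section \<open>The variance-reduced gradient as a function of the batch\<close>

locale smooth_average =
  fixes N :: nat and f :: "nat \<Rightarrow> 'a::euclidean_space \<Rightarrow> real" and L :: real
  assumes N_pos: "0 < N"
    and differentiable: "\<And>i y. i \<in> {1..N} \<Longrightarrow> f i differentiable (at y)"
    and lipschitz: "\<And>i. i \<in> {1..N} \<Longrightarrow> L-lipschitz_on UNIV (gradient (f i))"
begin

abbreviation F :: "'a \<Rightarrow> real" where "F \<equiv> avg N f"
abbreviation g :: "'a \<Rightarrow> 'a" where "g \<equiv> gradient (avg N f)"

lemma L_nonneg: "0 \<le> L"
  using lipschitz[of 1] N_pos lipschitz_on_nonneg by force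

lemma g_eq: "g y = (1 / real N) *\<^sub>R (\<Sum>i=1..N. gradient (f i) y)"
  by (intro gradient_eqI GDERIV_avg differentiable)

lemma F_differentiable: "F differentiable (at y)"
proof -
  have "GDERIV F y :> (1 / real N) *\<^sub>R (\<Sum>i=1..N. gradient (f i) y)"
    by (intro GDERIV_avg differentiable)
  then show ?thesis unfolding gderiv_def differentiable_def by blast
qed

lemma g_lipschitz: "L-lipschitz_on UNIV g"
proof (rule lipschitz_onI)
  fix y z :: 'a
  have "dist (g y) (g z) = (1 / real N) * norm (\<Sum>i=1..N. gradient (f i) y - gradient (f i) z)"
    using N_pos by (simp add: dist_norm g_eq sum_subtractf scaleR_diff_right[symmetric])
  also have "\<dots> \<le> (1 / real N) * (\<Sum>i=1..N. L * dist y z)"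
    using lipschitz_onD[OF lipschitz]
    by (intro mult_left_mono sum_norm_le) (auto simp: dist_norm)
  finally show "dist (g y) (g z) \<le> L * dist y z" using N_pos by simp
qed (rule L_nonneg)

lemma continuous_gradient: "i \<in> {1..N} \<Longrightarrow> continuous_on UNIV (gradient (f i))"
  using lipschitz lipschitz_on_continuous_on by blast

lemma continuous_g: "continuous_on UNIV g"
  using g_lipschitz lipschitz_on_continuous_on by blast

lemma continuous_F: "continuous_on UNIV F"
  using F_differentiable by (simp add: continuous_on_eq_continuous_at differentiable_imp_continuous_within)

text \<open>The error is that of a sampled mean of the differences \<open>\<nabla>f\<^sub>i y - \<nabla>f\<^sub>i y0\<close>, which are small when
  \<open>y\<close> is close to the reference point; this is the point of variance reduction.\<close>

lemma vr_error_eq: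
  "vr_gradient N b f J y y0 - g y
     = (1 / real b) *\<^sub>R (\<Sum>i\<in>J. gradient (f i) y - gradient (f i) y0)
       - (1 / real N) *\<^sub>R (\<Sum>i=1..N. gradient (f i) y - gradient (f i) y0)"
  by (simp add: vr_gradient_def g_eq sum_subtractf scaleR_diff_right)

lemma vr_gradient_unbiased:
  assumes b: "1 \<le> b" "b \<le> N"
  shows "(\<Sum>J\<in>batches N b. vr_gradient N b f J y y0 - g y) = 0"
proof -
  define v where "v i = gradient (f i) y - gradient (f i) y0" for i
  have "(\<Sum>J\<in>batches N b. vr_gradient N b f J y y0 - g y)
      = (1 / real b) *\<^sub>R (\<Sum>J\<in>batches N b. \<Sum>i\<in>J. v i)
        - real (N choose b) *\<^sub>R ((1 / real N) *\<^sub>R (\<Sum>i=1..N. v i))"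
    unfolding vr_error_eq v_def[symmetric] sum_subtractf
    by (simp add: scaleR_sum_right[symmetric] card_batches sum_constant_scaleR del: sum_constant)
  also have "\<dots> = 0" unfolding sum_batches_sum[OF b(1)] batch_ratio[OF b] using b by simp
  finally show ?thesis .
qed

lemma vr_gradient_variance:
  assumes b: "1 \<le> b" "b \<le> N"
  shows "(\<Sum>J\<in>batches N b. (norm (vr_gradient N b f J y y0 - g y))\<^sup>2)
           \<le> real (card (batches N b)) * (L\<^sup>2 / real b * (norm (y - y0))\<^sup>2)"
proof -
  have "(\<Sum>J\<in>batches N b. (norm (vr_gradient N b f J y y0 - g y))\<^sup>2)
      \<le> real (card (batches N b)) / (real b * real N) *
          (\<Sum>i=1..N. (norm (gradient (f i) y - gradient (f i) y0))\<^sup>2)"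
    unfolding vr_error_eq by (rule batch_mean_variance[OF b refl])
  also have "\<dots> \<le> real (card (batches N b)) / (real b * real N) * (\<Sum>i=1..N. (L * norm (y - y0))\<^sup>2)"
    using lipschitz_onD[OF lipschitz]
    by (intro mult_left_mono sum_mono power_mono) (auto simp: dist_norm)
  also have "\<dots> = real (card (batches N b)) * (L\<^sup>2 / real b * (norm (y - y0))\<^sup>2)"
    using N_pos by (simp add: power_mult_distrib)
  finally show ?thesis .
qed

text \<open>A crude bound for each single batch, sufficient for integrability.\<close>

lemma vr_gradient_error_le:
  assumes b: "1 \<le> b" "b \<le> N" and J: "J \<in> batches N b"
  shows "(norm (vr_gradient N b f J y y0 - g y))\<^sup>2
           \<le> real (card (batches N b)) * (L\<^sup>2 / real b * (norm (y - y0))\<^sup>2)"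
  using member_le_sum[OF J, of "\<lambda>J. (norm (vr_gradient N b f J y y0 - g y))\<^sup>2"]
    vr_gradient_variance[OF b, of y y0] finite_batches by force

end

section \<open>Expectations over a freshly drawn batch\<close>

context trsvr
begin

lemma card_batches_pos: "0 < card (batches N b)"
  using batch_size by (simp add: card_batches zero_less_binomial)

lemma space_history: "space (history M S x I k s) = space M"
  by (simp add: history_def space_measure_of_conv)

lemma history_generated:
  assumes "B \<in> sets borel" "s' \<le> s" "s \<le> S"
  shows "x k s' -` B \<inter> space M \<in> sets (history M S x I k s)"
proof -
  have "x k s' -` B \<inter> space M \<in> {x k' s' -` B \<inter> space M | k' s' B.
         s' \<le> S \<and> (k' < k \<or> k' = k \<and> s' \<le> s) \<and> B \<in> sets borel} \<union>
      {I k' s' -` \<J> \<inter> space M | k' s' \<J>.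
         s' < S \<and> (k' < k \<or> k' = k \<and> s' < s)}"
    using assms by (intro UnI1 CollectI exI[of _ k] exI[of _ s'] exI[of _ B]) auto
  then show ?thesis unfolding history_def by (subst sets_measure_of) auto
qed

lemma iterate_history_measurable:
  "s' \<le> s \<Longrightarrow> s \<le> S \<Longrightarrow> x k s' \<in> borel_measurable (history M S x I k s)"
  by (intro measurableI) (auto simp: space_history history_generated)

lemma sets_history_le: "s < S \<Longrightarrow> sets (history M S x I k s) \<subseteq> sets M"
  using indep_setD_ev1[OF batch_indep] .

lemma prob_batch:
  assumes s: "s < S" and J: "J \<in> batches N b"
  shows "prob (I k s -` {J} \<inter> space M) = 1 / real (card (batches N b))"
proof -
  have "prob (I k s -` {J} \<inter> space M) = measure (distr M (count_space (batches N b)) (I k s)) {J}"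
    using J batch_measurable[OF s] by (subst measure_distr) auto
  also have "\<dots> = 1 / real (card (batches N b))"
    using J by (simp add: batch_uniform[OF s] measure_uniform_count_measure finite_batches)
  finally show ?thesis .
qed

lemma indep_batch_event:
  fixes W :: "'w \<Rightarrow> real"
  assumes s: "s < S" and J: "J \<in> batches N b" and W: "W \<in> borel_measurable (history M S x I k s)"
  shows "indep_var borel W borel (indicator (I k s -` {J} \<inter> space M) :: 'w \<Rightarrow> real)"
proof -
  let ?H = "history M S x I k s" and ?V = "vimage_algebra (space M) (I k s) (count_space (batches N b))"
  let ?A = "I k s -` {J} \<inter> space M"
  have ind: "indep_set (sets ?H) (sets ?V)" by (rule batch_indep[OF s])
  have A: "?A \<in> sets ?V" using J by (intro in_vimage_algebra) auto
  then have iV: "(indicator ?A :: 'w \<Rightarrow> real) \<in> borel_measurable ?V" by simp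
  have subH: "sigma_sets (space M) {W -` B \<inter> space M | B. B \<in> sets borel} \<subseteq> sets ?H"
    using measurable_sets[OF W] sets.sigma_sets_subset[of "{W -` B \<inter> space M | B. B \<in> sets borel}" ?H]
    by (auto simp: space_history)
  have subV: "sigma_sets (space M) {indicator ?A -` B \<inter> space M | B. B \<in> sets (borel :: real measure)}
      \<subseteq> sets ?V"
    using measurable_sets[OF iV]
      sets.sigma_sets_subset[of "{indicator ?A -` B \<inter> space M | B. B \<in> sets (borel :: real measure)}" ?V]
    by auto
  have "W \<in> borel_measurable M"
    using measurable_sets[OF W] sets_history_le[OF s]
    by (intro measurableI) (auto simp: space_history)
  moreover have "(indicator ?A :: 'w \<Rightarrow> real) \<in> borel_measurable M"
    using A indep_setD_ev2[OF ind] by (intro borel_measurable_indicator) auto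
  moreover have "indep_set (sigma_sets (space M) {W -` B \<inter> space M | B. B \<in> sets borel})
      (sigma_sets (space M) {indicator ?A -` B \<inter> space M | B. B \<in> sets (borel :: real measure)})"
    using ind subH subV unfolding indep_sets2_eq by blast
  ultimately show ?thesis unfolding indep_var_eq by blast
qed

text \<open>Freezing: if each \<open>W J\<close> is determined by the history, then evaluating at the random batch
  and taking expectations amounts to averaging over all batches. The batch takes finitely many
  values, so it suffices to split the space according to its value and to use independence on each piece.\<close>

lemma
  fixes W :: "nat set \<Rightarrow> 'w \<Rightarrow> real"
  assumes s: "s < S"
    and W: "\<And>J. J \<in> batches N b \<Longrightarrow> W J \<in> borel_measurable (history M S x I k s)"
    and int: "\<And>J. J \<in> batches N b \<Longrightarrow> integrable M (W J)"
  shows integrable_at_batch: "integrable M (\<lambda>\<omega>. W (I k s \<omega>) \<omega>)"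
    and expectation_at_batch: "expectation (\<lambda>\<omega>. W (I k s \<omega>) \<omega>)
      = (\<Sum>J\<in>batches N b. expectation (W J)) / real (card (batches N b))"
proof -
  define A where "A J = I k s -` {J} \<inter> space M" for J
  have split: "W (I k s \<omega>) \<omega> = (\<Sum>J\<in>batches N b. W J \<omega> * indicator (A J) \<omega>)"
    if \<omega>: "\<omega> \<in> space M" for \<omega>
  proof -
    have "I k s \<omega> \<in> batches N b" using measurable_space[OF batch_measurable[OF s] \<omega>] by simp
    moreover have "(\<Sum>J\<in>batches N b. W J \<omega> * indicator (A J) \<omega>)
        = (\<Sum>J\<in>batches N b. if J = I k s \<omega> then W J \<omega> else 0)"
      using \<omega> by (intro sum.cong refl) (auto simp: A_def indicator_def)
    ultimately show ?thesis by (simp add: sum.delta[OF finite_batches])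
  qed
  have meas_A: "A J \<in> sets M" if "J \<in> batches N b" for J
    using measurable_sets[OF batch_measurable[OF s]] that unfolding A_def by auto
  have iA: "integrable M (indicator (A J) :: 'w \<Rightarrow> real)" if "J \<in> batches N b" for J
    using meas_A[OF that] by (simp add: emeasure_eq_measure)
  have indep: "indep_var borel (W J) borel (indicator (A J) :: 'w \<Rightarrow> real)" if "J \<in> batches N b" for J
    using indep_batch_event[OF s that W[OF that]] by (simp add: A_def)
  have prodi: "integrable M (\<lambda>\<omega>. W J \<omega> * indicator (A J) \<omega>)" if "J \<in> batches N b" for J
    by (rule indep_var_integrable[OF indep int iA]) fact+
  have prode: "expectation (\<lambda>\<omega>. W J \<omega> * indicator (A J) \<omega>) = expectation (W J) / real (card (batches N b))"
    if J: "J \<in> batches N b" for J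
  proof -
    have "expectation (\<lambda>\<omega>. W J \<omega> * indicator (A J) \<omega>) = expectation (W J) * expectation (indicator (A J))"
      by (rule indep_var_lebesgue_integral[OF indep int iA]) fact+
    moreover have "expectation (indicator (A J)) = 1 / real (card (batches N b))"
      using prob_batch[OF s J] meas_A[OF J] by (simp add: A_def)
    ultimately show ?thesis by simp
  qed
  have "integrable M (\<lambda>\<omega>. \<Sum>J\<in>batches N b. W J \<omega> * indicator (A J) \<omega>)"
    by (intro Bochner_Integration.integrable_sum prodi)
  then show "integrable M (\<lambda>\<omega>. W (I k s \<omega>) \<omega>)"
    by (subst Bochner_Integration.integrable_cong[OF refl split])
  have "expectation (\<lambda>\<omega>. W (I k s \<omega>) \<omega>) = expectation (\<lambda>\<omega>. \<Sum>J\<in>batches N b. W J \<omega> * indicator (A J) \<omega>)"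
    by (intro Bochner_Integration.integral_cong refl split)
  also have "\<dots> = (\<Sum>J\<in>batches N b. expectation (\<lambda>\<omega>. W J \<omega> * indicator (A J) \<omega>))"
    by (intro Bochner_Integration.integral_sum prodi)
  also have "\<dots> = (\<Sum>J\<in>batches N b. expectation (W J)) / real (card (batches N b))"
    by (simp add: prode sum_divide_distrib)
  finally show "expectation (\<lambda>\<omega>. W (I k s \<omega>) \<omega>)
      = (\<Sum>J\<in>batches N b. expectation (W J)) / real (card (batches N b))" .
qed

end

section \<open>Expected behaviour of a regular run\<close>

lemma norm_square_via_error:
  fixes u w :: "'a::real_inner"
  shows "(norm w)\<^sup>2 = (norm u)\<^sup>2 + (norm (w - u))\<^sup>2 + 2 * (u \<bullet> (w - u))"
  by (simp add: power2_norm_eq_inner inner_diff_left inner_diff_right inner_commute)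

locale regular_trsvr = trsvr M N b S \<alpha> f x I H
  for M :: "'w measure" and N b S :: nat and \<alpha> :: real
    and f :: "nat \<Rightarrow> real^'d \<Rightarrow> real" and x :: "nat \<Rightarrow> nat \<Rightarrow> 'w \<Rightarrow> real^'d"
    and I :: "nat \<Rightarrow> nat \<Rightarrow> 'w \<Rightarrow> nat set" and H :: "nat \<Rightarrow> nat \<Rightarrow> 'w \<Rightarrow> real^'d^'d" +
  fixes L \<kappa> f_inf :: real and X :: "(real^'d) set"
  assumes regular: "regularity M N S L \<kappa> f_inf X f x H"
    and integrable_start: "integrable M (\<lambda>\<omega>. avg N f (x 0 0 \<omega>))"

sublocale regular_trsvr \<subseteq> smooth_average N f L
  using batch_size regular by unfold_locales (auto simp: regularity_def)

context regular_trsvr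
begin

abbreviation q :: "nat \<Rightarrow> nat \<Rightarrow> 'w \<Rightarrow> real^'d" where
  "q k s \<omega> \<equiv> vr_gradient N b f (I k s \<omega>) (x k s \<omega>) (x k 0 \<omega>)"

abbreviation err :: "nat \<Rightarrow> nat \<Rightarrow> 'w \<Rightarrow> real^'d" where
  "err k s \<omega> \<equiv> q k s \<omega> - g (x k s \<omega>)"

lemma F_ge: "f_inf \<le> F y"
  using regular by (simp add: regularity_def)

lemma H_le: "s < S \<Longrightarrow> \<omega> \<in> space M \<Longrightarrow> onorm (\<lambda>v. H k s \<omega> *v v) \<le> \<kappa>"
  using regular by (simp add: regularity_def)

lemma g_square_le: "(norm (g y))\<^sup>2 \<le> 2 * (L + 1) * (F y - f_inf)"
  by (rule norm_gradient_le_gap[OF F_differentiable g_lipschitz F_ge]) simp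

lemma step_length:
  assumes "s < S" "\<omega> \<in> space M"
  shows "norm (x k (Suc s) \<omega> - x k s \<omega>) \<le> \<alpha> * norm (q k s \<omega>)"
proof -
  obtain p where p: "approx_tr_solution (q k s \<omega>) (H k s \<omega>) (\<alpha> * norm (q k s \<omega>)) p"
    "x k (Suc s) \<omega> = x k s \<omega> + p"
    using inner_step[OF assms, of k] by (auto simp: Let_def)
  then show ?thesis by (simp add: approx_tr_solution_def)
qed

text \<open>The step is \<open>- \<alpha> q\<close> up to a vector of norm at most \<open>\<delta> \<alpha> \<parallel>q\<parallel>\<close>. The leading term \<open>\<alpha> (g \<bullet> q)\<close> is kept
  exactly, because only its expectation is favourable; all the rest carries a factor \<open>\<delta>\<close>.\<close>

lemma step_descent:
  assumes s: "s < S" and \<omega>: "\<omega> \<in> space M"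
    and \<delta>: "0 \<le> \<delta>" "2 * \<kappa> * \<alpha> \<le> \<delta>\<^sup>2" "L * \<alpha> \<le> \<delta>"
  shows "F (x k (Suc s) \<omega>) \<le> F (x k s \<omega>) - \<alpha> * (g (x k s \<omega>) \<bullet> q k s \<omega>)
    + \<alpha> * \<delta> / 2 * (norm (g (x k s \<omega>)))\<^sup>2 + \<alpha> * \<delta> * (norm (q k s \<omega>))\<^sup>2"
proof -
  let ?y = "x k s \<omega>" and ?q = "q k s \<omega>"
  obtain p where p: "approx_tr_solution ?q (H k s \<omega>) (\<alpha> * norm ?q) p" "x k (Suc s) \<omega> = ?y + p"
    using inner_step[OF s \<omega>, of k] by (auto simp: Let_def)
  note tr = trust_region_step[OF p(1) H_le[OF s \<omega>] radius_control_pos]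
  have "(norm (p + \<alpha> *\<^sub>R ?q))\<^sup>2 \<le> (2 * \<kappa> * \<alpha>) * \<alpha>\<^sup>2 * (norm ?q)\<^sup>2"
    using tr(2) by (simp add: power2_eq_square power3_eq_cube mult_ac)
  also have "\<dots> \<le> \<delta>\<^sup>2 * \<alpha>\<^sup>2 * (norm ?q)\<^sup>2"
    using \<delta> by (intro mult_right_mono) auto
  finally have "(norm (p + \<alpha> *\<^sub>R ?q))\<^sup>2 \<le> (\<delta> * \<alpha> * norm ?q)\<^sup>2" by (simp add: power_mult_distrib)
  then have r: "norm (p + \<alpha> *\<^sub>R ?q) \<le> \<delta> * \<alpha> * norm ?q"
    by (rule power2_le_imp_le) (use \<delta> radius_control_pos in auto)
  have "g ?y \<bullet> p = - \<alpha> * (g ?y \<bullet> ?q) + g ?y \<bullet> (p + \<alpha> *\<^sub>R ?q)" by (simp add: inner_add_right)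
  also have "g ?y \<bullet> (p + \<alpha> *\<^sub>R ?q) \<le> norm (g ?y) * norm (p + \<alpha> *\<^sub>R ?q)" by (rule norm_cauchy_schwarz)
  also have "\<dots> \<le> norm (g ?y) * (\<delta> * \<alpha> * norm ?q)" by (intro mult_left_mono r) simp
  also have "\<dots> = \<alpha> * \<delta> / 2 * (2 * norm (g ?y) * norm ?q)" by simp
  also have "\<dots> \<le> \<alpha> * \<delta> / 2 * ((norm (g ?y))\<^sup>2 + (norm ?q)\<^sup>2)"
    using \<delta> radius_control_pos by (intro mult_left_mono sum_squares_bound) auto
  finally have gp: "g ?y \<bullet> p \<le> - \<alpha> * (g ?y \<bullet> ?q) + \<alpha> * \<delta> / 2 * ((norm (g ?y))\<^sup>2 + (norm ?q)\<^sup>2)" by simp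
  have "L / 2 * (norm p)\<^sup>2 \<le> L / 2 * (\<alpha> * norm ?q)\<^sup>2"
    using tr(1) L_nonneg by (intro mult_left_mono power_mono) auto
  also have "\<dots> = \<alpha> / 2 * (norm ?q)\<^sup>2 * (L * \<alpha>)" by (simp add: power2_eq_square)
  also have "\<dots> \<le> \<alpha> / 2 * (norm ?q)\<^sup>2 * \<delta>"
    using \<delta> radius_control_pos by (intro mult_left_mono) auto
  finally have Lp: "L / 2 * (norm p)\<^sup>2 \<le> \<alpha> / 2 * (norm ?q)\<^sup>2 * \<delta>" .
  have "F (?y + p) \<le> F ?y + g ?y \<bullet> p + L / 2 * (norm p)\<^sup>2"
    by (rule descent_inequality[OF F_differentiable g_lipschitz])
  with gp Lp show ?thesis by (simp add: p(2) algebra_simps)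
qed

lemma displacement_le:
  assumes "s \<le> S" "\<omega> \<in> space M"
  shows "(norm (x k s \<omega> - x k 0 \<omega>))\<^sup>2 \<le> real s * \<alpha>\<^sup>2 * (\<Sum>j<s. (norm (q k j \<omega>))\<^sup>2)"
proof -
  have "(norm (x k s \<omega> - x k 0 \<omega>))\<^sup>2 = (norm (\<Sum>j<s. x k (Suc j) \<omega> - x k j \<omega>))\<^sup>2"
    by (simp add: sum_lessThan_telescope[of "\<lambda>j. x k j \<omega>"])
  also have "\<dots> \<le> real s * (\<Sum>j<s. (norm (x k (Suc j) \<omega> - x k j \<omega>))\<^sup>2)"
    by (rule norm_sum_square_le)
  also have "\<dots> \<le> real s * (\<Sum>j<s. (\<alpha> * norm (q k j \<omega>))\<^sup>2)"
    using assms by (intro mult_left_mono sum_mono power_mono step_length) auto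
  finally show ?thesis by (simp add: power_mult_distrib sum_distrib_left mult_ac)
qed

lemma iterate_measurable_compose:
  fixes h :: "real^'d \<Rightarrow> 'b::topological_space"
  assumes "continuous_on UNIV h" "s \<le> S"
  shows "(\<lambda>\<omega>. h (x k s \<omega>)) \<in> borel_measurable M"
  using borel_measurable_continuous_onI[OF assms(1)] iterate_measurable[OF assms(2)]
  by (rule measurable_compose[rotated])

lemma vr_error_history_measurable:
  assumes s: "s \<le> S" and J: "J \<in> batches N b"
  shows "(\<lambda>\<omega>. vr_gradient N b f J (x k s \<omega>) (x k 0 \<omega>) - g (x k s \<omega>))
           \<in> borel_measurable (history M S x I k s)"
proof -
  have grad: "(\<lambda>\<omega>. gradient (f i) (x k s' \<omega>)) \<in> borel_measurable (history M S x I k s)"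
    if "i \<in> {1..N}" "s' \<le> s" for i s'
    using borel_measurable_continuous_onI[OF continuous_gradient[OF that(1)]]
      iterate_history_measurable[OF that(2) s] by (rule measurable_compose[rotated])
  have "J \<subseteq> {1..N}" using J by (simp add: batches_def)
  then show ?thesis
    unfolding vr_error_eq
    by (intro borel_measurable_diff borel_measurable_scaleR borel_measurable_const borel_measurable_sum grad) auto
qed

lemma g_history_measurable:
  "s \<le> S \<Longrightarrow> (\<lambda>\<omega>. g (x k s \<omega>)) \<in> borel_measurable (history M S x I k s)"
  using borel_measurable_continuous_onI[OF continuous_g] iterate_history_measurable[OF order_refl]
  by (rule measurable_compose[rotated])

lemma integrable_if_dominated:
  fixes u v :: "'w \<Rightarrow> real"
  assumes "integrable M v" "u \<in> borel_measurable M" "\<And>\<omega>. \<omega> \<in> space M \<Longrightarrow> \<bar>u \<omega>\<bar> \<le> v \<omega>"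
  shows "integrable M u"
  using assms(1,2) by (rule Bochner_Integration.integrable_bound) (use assms(3) in \<open>force intro!: AE_I2\<close>)

lemma integrable_g:
  assumes "s \<le> S" "integrable M (\<lambda>\<omega>. F (x k s \<omega>))"
  shows "integrable M (\<lambda>\<omega>. (norm (g (x k s \<omega>)))\<^sup>2)"
proof (rule integrable_if_dominated)
  show "integrable M (\<lambda>\<omega>. 2 * (L + 1) * (F (x k s \<omega>) - f_inf))" using assms by simp
  show "(\<lambda>\<omega>. (norm (g (x k s \<omega>)))\<^sup>2) \<in> borel_measurable M"
    using iterate_measurable_compose[OF continuous_g assms(1), of k] by measurable
qed (use g_square_le in simp)

text \<open>The batch is independent of \<open>x k s\<close> and of \<open>x k 0\<close>, so the averages over all batches give
  the conditional mean and variance of the sampling error.\<close>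

lemma
  assumes s: "s < S" and F: "integrable M (\<lambda>\<omega>. F (x k s \<omega>))"
    and D: "integrable M (\<lambda>\<omega>. (norm (x k s \<omega> - x k 0 \<omega>))\<^sup>2)"
  shows integrable_error: "integrable M (\<lambda>\<omega>. (norm (err k s \<omega>))\<^sup>2)"
    and expectation_error_le: "expectation (\<lambda>\<omega>. (norm (err k s \<omega>))\<^sup>2)
          \<le> L\<^sup>2 / real b * expectation (\<lambda>\<omega>. (norm (x k s \<omega> - x k 0 \<omega>))\<^sup>2)"
    and integrable_cross: "integrable M (\<lambda>\<omega>. g (x k s \<omega>) \<bullet> err k s \<omega>)"
    and expectation_cross: "expectation (\<lambda>\<omega>. g (x k s \<omega>) \<bullet> err k s \<omega>) = 0"
proof -
  define E where "E J \<omega> = vr_gradient N b f J (x k s \<omega>) (x k 0 \<omega>) - g (x k s \<omega>)" for J \<omega>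
  define D2 where "D2 \<omega> = (norm (x k s \<omega> - x k 0 \<omega>))\<^sup>2" for \<omega>
  define C where "C = real (card (batches N b))"
  have C: "0 < C" using card_batches_pos by (simp add: C_def)
  have D2: "integrable M D2" using D by (simp add: D2_def[abs_def])
  have measE: "E J \<in> borel_measurable (history M S x I k s)" if "J \<in> batches N b" for J
    using vr_error_history_measurable[OF _ that] s by (simp add: E_def[abs_def])
  have mono: "h \<in> borel_measurable M" if "h \<in> borel_measurable (history M S x I k s)" for h :: "'w \<Rightarrow> real"
    using measurable_sets[OF that] sets_history_le[OF s] by (intro measurableI) (auto simp: space_history)
  have measg: "(\<lambda>\<omega>. g (x k s \<omega>)) \<in> borel_measurable (history M S x I k s)"
    using g_history_measurable s by simp
  have measE2: "(\<lambda>\<omega>. (norm (E J \<omega>))\<^sup>2) \<in> borel_measurable (history M S x I k s)" if "J \<in> batches N b" for J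
    using measE[OF that] by measurable
  have measgE: "(\<lambda>\<omega>. g (x k s \<omega>) \<bullet> E J \<omega>) \<in> borel_measurable (history M S x I k s)" if "J \<in> batches N b" for J
    using measE[OF that] measg by measurable
  have intE: "integrable M (\<lambda>\<omega>. (norm (E J \<omega>))\<^sup>2)" if J: "J \<in> batches N b" for J
  proof (rule integrable_if_dominated)
    show "integrable M (\<lambda>\<omega>. C * (L\<^sup>2 / real b * D2 \<omega>))" using D2 by simp
    show "(\<lambda>\<omega>. (norm (E J \<omega>))\<^sup>2) \<in> borel_measurable M" by (rule mono[OF measE2[OF J]])
  qed (use vr_gradient_error_le[OF batch_size J] in \<open>simp add: E_def C_def D2_def\<close>)
  have intg: "integrable M (\<lambda>\<omega>. (norm (g (x k s \<omega>)))\<^sup>2)" using s F by (intro integrable_g) auto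
  have intgE: "integrable M (\<lambda>\<omega>. g (x k s \<omega>) \<bullet> E J \<omega>)" if J: "J \<in> batches N b" for J
  proof (rule integrable_if_dominated)
    show "integrable M (\<lambda>\<omega>. (norm (g (x k s \<omega>)))\<^sup>2 + (norm (E J \<omega>))\<^sup>2)" using intg intE[OF J] by simp
    show "(\<lambda>\<omega>. g (x k s \<omega>) \<bullet> E J \<omega>) \<in> borel_measurable M" by (rule mono[OF measgE[OF J]])
    fix \<omega>
    have "\<bar>g (x k s \<omega>) \<bullet> E J \<omega>\<bar> \<le> norm (g (x k s \<omega>)) * norm (E J \<omega>)" by (rule Cauchy_Schwarz_ineq2)
    also have "\<dots> \<le> 2 * norm (g (x k s \<omega>)) * norm (E J \<omega>)" by simp
    also have "\<dots> \<le> (norm (g (x k s \<omega>)))\<^sup>2 + (norm (E J \<omega>))\<^sup>2" by (rule sum_squares_bound)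
    finally show "\<bar>g (x k s \<omega>) \<bullet> E J \<omega>\<bar> \<le> (norm (g (x k s \<omega>)))\<^sup>2 + (norm (E J \<omega>))\<^sup>2" .
  qed
  show "integrable M (\<lambda>\<omega>. (norm (err k s \<omega>))\<^sup>2)"
    using integrable_at_batch[OF s measE2 intE] by (simp add: E_def)
  show "integrable M (\<lambda>\<omega>. g (x k s \<omega>) \<bullet> err k s \<omega>)"
    using integrable_at_batch[OF s measgE intgE] by (simp add: E_def)
  have "expectation (\<lambda>\<omega>. (norm (err k s \<omega>))\<^sup>2) = (\<Sum>J\<in>batches N b. expectation (\<lambda>\<omega>. (norm (E J \<omega>))\<^sup>2)) / C"
    using expectation_at_batch[OF s measE2 intE] by (simp add: E_def C_def)
  also have "\<dots> = expectation (\<lambda>\<omega>. \<Sum>J\<in>batches N b. (norm (E J \<omega>))\<^sup>2) / C"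
    by (subst Bochner_Integration.integral_sum) (auto intro: intE)
  also have "\<dots> \<le> expectation (\<lambda>\<omega>. C * (L\<^sup>2 / real b * D2 \<omega>)) / C"
  proof (intro divide_right_mono integral_mono)
    show "integrable M (\<lambda>\<omega>. \<Sum>J\<in>batches N b. (norm (E J \<omega>))\<^sup>2)"
      by (intro Bochner_Integration.integrable_sum intE)
    show "integrable M (\<lambda>\<omega>. C * (L\<^sup>2 / real b * D2 \<omega>))" by (intro integrable_mult_right D2)
    show "(\<Sum>J\<in>batches N b. (norm (E J \<omega>))\<^sup>2) \<le> C * (L\<^sup>2 / real b * D2 \<omega>)" for \<omega>
      unfolding E_def C_def D2_def by (rule vr_gradient_variance[OF batch_size])
  qed (use C in simp)
  also have "\<dots> = L\<^sup>2 / real b * expectation D2" using C by simp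
  finally show "expectation (\<lambda>\<omega>. (norm (err k s \<omega>))\<^sup>2)
          \<le> L\<^sup>2 / real b * expectation (\<lambda>\<omega>. (norm (x k s \<omega> - x k 0 \<omega>))\<^sup>2)"
    by (simp add: D2_def[abs_def])
  have "expectation (\<lambda>\<omega>. g (x k s \<omega>) \<bullet> err k s \<omega>) = (\<Sum>J\<in>batches N b. expectation (\<lambda>\<omega>. g (x k s \<omega>) \<bullet> E J \<omega>)) / C"
    using expectation_at_batch[OF s measgE intgE] by (simp add: E_def C_def)
  also have "\<dots> = expectation (\<lambda>\<omega>. \<Sum>J\<in>batches N b. g (x k s \<omega>) \<bullet> E J \<omega>) / C"
    by (subst Bochner_Integration.integral_sum) (auto intro: intgE)
  also have "(\<lambda>\<omega>. \<Sum>J\<in>batches N b. g (x k s \<omega>) \<bullet> E J \<omega>) = (\<lambda>\<omega>. 0)"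
    using vr_gradient_unbiased[OF batch_size] by (simp add: E_def inner_sum_right[symmetric])
  finally show "expectation (\<lambda>\<omega>. g (x k s \<omega>) \<bullet> err k s \<omega>) = 0" by simp
qed

lemma
  assumes s: "s < S" and F: "integrable M (\<lambda>\<omega>. F (x k s \<omega>))"
    and D: "integrable M (\<lambda>\<omega>. (norm (x k s \<omega> - x k 0 \<omega>))\<^sup>2)"
  shows integrable_q: "integrable M (\<lambda>\<omega>. (norm (q k s \<omega>))\<^sup>2)"
    and expectation_q: "expectation (\<lambda>\<omega>. (norm (q k s \<omega>))\<^sup>2)
      = expectation (\<lambda>\<omega>. (norm (g (x k s \<omega>)))\<^sup>2) + expectation (\<lambda>\<omega>. (norm (err k s \<omega>))\<^sup>2)"
    and integrable_gq: "integrable M (\<lambda>\<omega>. g (x k s \<omega>) \<bullet> q k s \<omega>)"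
    and expectation_gq: "expectation (\<lambda>\<omega>. g (x k s \<omega>) \<bullet> q k s \<omega>) = expectation (\<lambda>\<omega>. (norm (g (x k s \<omega>)))\<^sup>2)"
proof -
  note er = integrable_error[OF assms] and c = integrable_cross[OF assms] and c0 = expectation_cross[OF assms]
  have g: "integrable M (\<lambda>\<omega>. (norm (g (x k s \<omega>)))\<^sup>2)" using s F by (intro integrable_g) auto
  have q2: "(\<lambda>\<omega>. (norm (q k s \<omega>))\<^sup>2)
      = (\<lambda>\<omega>. (norm (g (x k s \<omega>)))\<^sup>2 + (norm (err k s \<omega>))\<^sup>2 + 2 * (g (x k s \<omega>) \<bullet> err k s \<omega>))"
    by (intro ext norm_square_via_error)
  have gq: "(\<lambda>\<omega>. g (x k s \<omega>) \<bullet> q k s \<omega>) = (\<lambda>\<omega>. (norm (g (x k s \<omega>)))\<^sup>2 + g (x k s \<omega>) \<bullet> err k s \<omega>)"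
    by (rule ext) (simp add: power2_norm_eq_inner inner_diff_right)
  show "integrable M (\<lambda>\<omega>. (norm (q k s \<omega>))\<^sup>2)"
    unfolding q2 by (intro Bochner_Integration.integrable_add integrable_mult_right g er c)
  show "integrable M (\<lambda>\<omega>. g (x k s \<omega>) \<bullet> q k s \<omega>)"
    unfolding gq by (intro Bochner_Integration.integrable_add g c)
  show "expectation (\<lambda>\<omega>. (norm (q k s \<omega>))\<^sup>2)
      = expectation (\<lambda>\<omega>. (norm (g (x k s \<omega>)))\<^sup>2) + expectation (\<lambda>\<omega>. (norm (err k s \<omega>))\<^sup>2)"
    unfolding q2 using g er c c0 by (simp del: inner_diff_right)
  show "expectation (\<lambda>\<omega>. g (x k s \<omega>) \<bullet> q k s \<omega>) = expectation (\<lambda>\<omega>. (norm (g (x k s \<omega>)))\<^sup>2)"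
    unfolding gq using g c c0 by simp
qed

text \<open>Both integrability claims must be carried through the induction together: values of \<open>F\<close> control
  the gradients, displacements control the sampling error, and these two control the next step.\<close>

lemma inner_loop_integrable:
  assumes F0: "integrable M (\<lambda>\<omega>. F (x k 0 \<omega>))"
  shows "s \<le> S \<Longrightarrow> integrable M (\<lambda>\<omega>. F (x k s \<omega>)) \<and> integrable M (\<lambda>\<omega>. (norm (x k s \<omega> - x k 0 \<omega>))\<^sup>2)"
proof (induction s)
  case 0
  then show ?case using F0 by simp
next
  case (Suc s)
  then have s: "s < S" and F: "integrable M (\<lambda>\<omega>. F (x k s \<omega>))"
    and D: "integrable M (\<lambda>\<omega>. (norm (x k s \<omega> - x k 0 \<omega>))\<^sup>2)" by auto
  have g: "integrable M (\<lambda>\<omega>. (norm (g (x k s \<omega>)))\<^sup>2)" using s F by (intro integrable_g) auto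
  note q = integrable_q[OF s F D]
  have p: "(norm (x k (Suc s) \<omega> - x k s \<omega>))\<^sup>2 \<le> \<alpha>\<^sup>2 * (norm (q k s \<omega>))\<^sup>2" if "\<omega> \<in> space M" for \<omega>
    using power_mono[OF step_length[OF s that, of k] norm_ge_zero, of 2] by (simp add: power_mult_distrib)
  have "integrable M (\<lambda>\<omega>. F (x k (Suc s) \<omega>))"
  proof (rule integrable_if_dominated)
    let ?v = "\<lambda>\<omega>. \<bar>f_inf\<bar> + \<bar>F (x k s \<omega>)\<bar> + (norm (g (x k s \<omega>)))\<^sup>2 + (1 + L / 2) * (\<alpha>\<^sup>2 * (norm (q k s \<omega>))\<^sup>2)"
    show "integrable M ?v" using F g q by simp
    show "(\<lambda>\<omega>. F (x k (Suc s) \<omega>)) \<in> borel_measurable M"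
      using s by (intro iterate_measurable_compose continuous_F) simp
    fix \<omega> assume \<omega>: "\<omega> \<in> space M"
    let ?p = "x k (Suc s) \<omega> - x k s \<omega>"
    have "F (x k s \<omega> + ?p) \<le> F (x k s \<omega>) + g (x k s \<omega>) \<bullet> ?p + L / 2 * (norm ?p)\<^sup>2"
      by (rule descent_inequality[OF F_differentiable g_lipschitz])
    moreover have "g (x k s \<omega>) \<bullet> ?p \<le> (norm (g (x k s \<omega>)))\<^sup>2 + (norm ?p)\<^sup>2"
      using norm_cauchy_schwarz[of "g (x k s \<omega>)" ?p] sum_squares_bound[of "norm (g (x k s \<omega>))" "norm ?p"]
        mult_nonneg_nonneg[OF norm_ge_zero norm_ge_zero, of "g (x k s \<omega>)" ?p] by linarith
    moreover have "(1 + L / 2) * (norm ?p)\<^sup>2 \<le> (1 + L / 2) * (\<alpha>\<^sup>2 * (norm (q k s \<omega>))\<^sup>2)"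
      using L_nonneg by (intro mult_left_mono p[OF \<omega>]) auto
    ultimately have up: "F (x k (Suc s) \<omega>) \<le> ?v \<omega>" by (simp add: algebra_simps)
    have "0 \<le> (norm (g (x k s \<omega>)))\<^sup>2 + (1 + L / 2) * (\<alpha>\<^sup>2 * (norm (q k s \<omega>))\<^sup>2)"
      using L_nonneg by (intro add_nonneg_nonneg mult_nonneg_nonneg) auto
    with F_ge[of "x k (Suc s) \<omega>"] have "- F (x k (Suc s) \<omega>) \<le> ?v \<omega>" by linarith
    with up show "\<bar>F (x k (Suc s) \<omega>)\<bar> \<le> ?v \<omega>" by (simp add: abs_le_iff)
  qed
  moreover have "integrable M (\<lambda>\<omega>. (norm (x k (Suc s) \<omega> - x k 0 \<omega>))\<^sup>2)"
  proof (rule integrable_if_dominated)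
    let ?v = "\<lambda>\<omega>. 2 * (\<alpha>\<^sup>2 * (norm (q k s \<omega>))\<^sup>2) + 2 * (norm (x k s \<omega> - x k 0 \<omega>))\<^sup>2"
    show "integrable M ?v" using q D by simp
    show "(\<lambda>\<omega>. (norm (x k (Suc s) \<omega> - x k 0 \<omega>))\<^sup>2) \<in> borel_measurable M"
    proof -
      have "(\<lambda>\<omega>. x k (Suc s) \<omega> - x k 0 \<omega>) \<in> borel_measurable M"
        using s by (intro borel_measurable_diff iterate_measurable) auto
      then show ?thesis by measurable
    qed
    fix \<omega> assume \<omega>: "\<omega> \<in> space M"
    let ?a = "x k (Suc s) \<omega> - x k s \<omega>" and ?b = "x k s \<omega> - x k 0 \<omega>"
    have "(norm (?a + ?b))\<^sup>2 \<le> (norm ?a + norm ?b)\<^sup>2" by (intro power_mono norm_triangle_ineq) simp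
    also have "\<dots> \<le> 2 * (norm ?a)\<^sup>2 + 2 * (norm ?b)\<^sup>2"
      using sum_squares_bound[of "norm ?a" "norm ?b"] by (simp add: power2_sum)
    also have "\<dots> \<le> ?v \<omega>" using p[OF \<omega>] by simp
    finally show "\<bar>(norm (x k (Suc s) \<omega> - x k 0 \<omega>))\<^sup>2\<bar> \<le> ?v \<omega>" by simp
  qed
  ultimately show ?case by blast
qed

lemma integrable_outer: "integrable M (\<lambda>\<omega>. F (x k 0 \<omega>))"
proof (induction k)
  case 0
  show ?case by (rule integrable_start)
next
  case (Suc k)
  have "integrable M (\<lambda>\<omega>. F (x (Suc k) 0 \<omega>)) = integrable M (\<lambda>\<omega>. F (x k S \<omega>))"
    by (intro Bochner_Integration.integrable_cong refl) (simp add: outer_step)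
  then show ?case using inner_loop_integrable[OF Suc, of S] by simp
qed

lemmas integrable_F = inner_loop_integrable[OF integrable_outer, THEN conjunct1]
lemmas integrable_displacement = inner_loop_integrable[OF integrable_outer, THEN conjunct2]

definition mean_F where "mean_F k s = expectation (\<lambda>\<omega>. F (x k s \<omega>))"
definition mean_g2 where "mean_g2 k s = expectation (\<lambda>\<omega>. (norm (g (x k s \<omega>)))\<^sup>2)"
definition mean_q2 where "mean_q2 k s = expectation (\<lambda>\<omega>. (norm (q k s \<omega>))\<^sup>2)"

lemma mean_g2_nonneg: "0 \<le> mean_g2 k s"
  unfolding mean_g2_def by (intro Bochner_Integration.integral_nonneg) simp

text \<open>The sampling error at step \<open>s\<close> is governed by the displacement from the reference point, and
  hence by the lengths of the earlier steps of the same epoch.\<close>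

lemma mean_q2_step:
  assumes s: "s < S"
  shows "mean_q2 k s \<le> mean_g2 k s + L\<^sup>2 * \<alpha>\<^sup>2 * real S / real b * (\<Sum>j<s. mean_q2 k j)"
proof -
  note int = integrable_F integrable_displacement
  have intq: "integrable M (\<lambda>\<omega>. (norm (q k j \<omega>))\<^sup>2)" if "j < S" for j
    using that by (intro integrable_q int) auto
  have q2_nonneg: "0 \<le> mean_q2 k j" for j unfolding mean_q2_def by (intro Bochner_Integration.integral_nonneg) simp
  have "expectation (\<lambda>\<omega>. (norm (x k s \<omega> - x k 0 \<omega>))\<^sup>2)
      \<le> expectation (\<lambda>\<omega>. real s * \<alpha>\<^sup>2 * (\<Sum>j<s. (norm (q k j \<omega>))\<^sup>2))"
    using s displacement_le intq
    by (intro integral_mono int integrable_mult_right Bochner_Integration.integrable_sum) auto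
  also have "\<dots> = real s * \<alpha>\<^sup>2 * (\<Sum>j<s. mean_q2 k j)"
    using s intq unfolding mean_q2_def by (subst integral_mult_right_zero) (subst Bochner_Integration.integral_sum, auto)
  also have "\<dots> \<le> real S * \<alpha>\<^sup>2 * (\<Sum>j<s. mean_q2 k j)"
    using s q2_nonneg by (intro mult_right_mono sum_nonneg) auto
  finally have "L\<^sup>2 / real b * expectation (\<lambda>\<omega>. (norm (x k s \<omega> - x k 0 \<omega>))\<^sup>2)
      \<le> L\<^sup>2 / real b * (real S * \<alpha>\<^sup>2 * (\<Sum>j<s. mean_q2 k j))"
    by (intro mult_left_mono) auto
  with expectation_error_le[OF s int[OF less_imp_le[OF s]], of k]
  show ?thesis
    using expectation_q[OF s int[OF less_imp_le[OF s]], of k]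
    unfolding mean_q2_def mean_g2_def by (simp add: mult_ac)
qed

lemma sum_mean_q2_le:
  "(\<Sum>s<S. mean_q2 k s) \<le> exp (L\<^sup>2 * \<alpha>\<^sup>2 * (real S)\<^sup>2 / real b) * (\<Sum>s<S. mean_g2 k s)"
proof -
  define a where "a = L\<^sup>2 * \<alpha>\<^sup>2 * real S / real b"
  have a: "0 \<le> a" by (simp add: a_def)
  have "(\<Sum>s<S. mean_q2 k s) \<le> (1 + a) ^ S * (\<Sum>s<S. mean_g2 k s)"
    by (rule sum_gronwall[OF a mean_g2_nonneg]) (unfold a_def, rule mean_q2_step)
  also have "\<dots> \<le> exp a ^ S * (\<Sum>s<S. mean_g2 k s)"
    using a mean_g2_nonneg by (intro mult_right_mono power_mono sum_nonneg) (auto simp: exp_ge_add_one_self)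
  also have "exp a ^ S = exp (L\<^sup>2 * \<alpha>\<^sup>2 * (real S)\<^sup>2 / real b)"
  proof -
    have "real S * a = L\<^sup>2 * \<alpha>\<^sup>2 * (real S)\<^sup>2 / real b" by (simp add: a_def power2_eq_square)
    then show ?thesis using exp_of_nat_mult[of S a] by simp
  qed
  finally show ?thesis .
qed

lemma mean_F_step:
  assumes s: "s < S" and \<delta>: "0 \<le> \<delta>" "2 * \<kappa> * \<alpha> \<le> \<delta>\<^sup>2" "L * \<alpha> \<le> \<delta>"
  shows "mean_F k (Suc s) \<le> mean_F k s - \<alpha> * mean_g2 k s + \<alpha> * \<delta> / 2 * mean_g2 k s + \<alpha> * \<delta> * mean_q2 k s"
proof -
  have F: "integrable M (\<lambda>\<omega>. F (x k s \<omega>))" and D: "integrable M (\<lambda>\<omega>. (norm (x k s \<omega> - x k 0 \<omega>))\<^sup>2)"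
    using s by (auto intro: integrable_F integrable_displacement)
  have g: "integrable M (\<lambda>\<omega>. (norm (g (x k s \<omega>)))\<^sup>2)" using s F by (intro integrable_g) auto
  note q = integrable_q[OF s F D] and gq = integrable_gq[OF s F D]
  have "mean_F k (Suc s) \<le> expectation (\<lambda>\<omega>. F (x k s \<omega>) - \<alpha> * (g (x k s \<omega>) \<bullet> q k s \<omega>)
    + \<alpha> * \<delta> / 2 * (norm (g (x k s \<omega>)))\<^sup>2 + \<alpha> * \<delta> * (norm (q k s \<omega>))\<^sup>2)"
    unfolding mean_F_def
  proof (rule integral_mono)
    show "integrable M (\<lambda>\<omega>. F (x k (Suc s) \<omega>))" using s by (intro integrable_F) simp
  next
    show "integrable M (\<lambda>\<omega>. F (x k s \<omega>) - \<alpha> * (g (x k s \<omega>) \<bullet> q k s \<omega>)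
        + \<alpha> * \<delta> / 2 * (norm (g (x k s \<omega>)))\<^sup>2 + \<alpha> * \<delta> * (norm (q k s \<omega>))\<^sup>2)"
      by (intro Bochner_Integration.integrable_add Bochner_Integration.integrable_diff
          integrable_mult_right F g q gq)
  qed (rule step_descent[OF s _ \<delta>])
  also have "\<dots> = mean_F k s - \<alpha> * mean_g2 k s + \<alpha> * \<delta> / 2 * mean_g2 k s + \<alpha> * \<delta> * mean_q2 k s"
    using F g q gq expectation_gq[OF s F D] by (simp add: mean_F_def mean_g2_def mean_q2_def)
  finally show ?thesis .
qed

text \<open>The perturbation terms carry the factor \<open>\<delta>\<close>. The product of \<open>\<delta>\<close> with the Gronwall factor, which
  bounds the sum of \<open>mean_q2\<close>, is at most \<open>1/4\<close>, so all of them together cost at most half of the leading term.\<close>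

lemma inner_loop_decrease:
  assumes \<delta>: "0 \<le> \<delta>" "2 * \<kappa> * \<alpha> \<le> \<delta>\<^sup>2" "L * \<alpha> \<le> \<delta>"
    and small: "\<delta> * exp (L\<^sup>2 * \<alpha>\<^sup>2 * (real S)\<^sup>2 / real b) \<le> 1 / 4"
  shows "\<alpha> / 2 * (\<Sum>s<S. mean_g2 k s) \<le> mean_F k 0 - mean_F k S"
proof -
  define B where "B = exp (L\<^sup>2 * \<alpha>\<^sup>2 * (real S)\<^sup>2 / real b)"
  define G where "G = (\<Sum>s<S. mean_g2 k s)"
  have G: "0 \<le> G" unfolding G_def by (intro sum_nonneg mean_g2_nonneg)
  have "\<delta> * 1 \<le> \<delta> * B" using \<delta> by (intro mult_left_mono) (auto simp: B_def)
  then have small': "\<delta> / 2 + \<delta> * B \<le> 1 / 2" using small by (simp add: B_def)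
  have "\<alpha> * G - \<alpha> * \<delta> / 2 * G - \<alpha> * \<delta> * (\<Sum>s<S. mean_q2 k s)
      = (\<Sum>s<S. \<alpha> * mean_g2 k s - \<alpha> * \<delta> / 2 * mean_g2 k s - \<alpha> * \<delta> * mean_q2 k s)"
    by (simp add: G_def sum_subtractf sum_distrib_left)
  also have "\<dots> \<le> (\<Sum>s<S. mean_F k s - mean_F k (Suc s))"
    using mean_F_step[OF _ \<delta>] by (intro sum_mono) (simp add: algebra_simps)
  also have "\<dots> = mean_F k 0 - mean_F k S" by (rule sum_lessThan_telescope')
  finally have 1: "\<alpha> * G - \<alpha> * \<delta> / 2 * G - \<alpha> * \<delta> * (\<Sum>s<S. mean_q2 k s) \<le> mean_F k 0 - mean_F k S" .
  have "\<alpha> * \<delta> * (\<Sum>s<S. mean_q2 k s) \<le> \<alpha> * \<delta> * (B * G)"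
    using sum_mean_q2_le[of k] \<delta> radius_control_pos by (intro mult_left_mono) (auto simp: B_def G_def)
  moreover have "\<alpha> * G * (\<delta> / 2 + \<delta> * B) \<le> \<alpha> * G * (1 / 2)"
    using small' G radius_control_pos by (intro mult_left_mono) auto
  ultimately show ?thesis using 1 by (simp add: algebra_simps G_def[symmetric])
qed

lemma mean_F_ge: "f_inf \<le> mean_F k 0"
  unfolding mean_F_def using integral_mono[OF _ integrable_outer[of k], of "\<lambda>_. f_inf"] F_ge
  by (simp add: prob_space)

lemma sum_mean_g2_le:
  assumes \<delta>: "0 \<le> \<delta>" "2 * \<kappa> * \<alpha> \<le> \<delta>\<^sup>2" "L * \<alpha> \<le> \<delta>"
    and small: "\<delta> * exp (L\<^sup>2 * \<alpha>\<^sup>2 * (real S)\<^sup>2 / real b) \<le> 1 / 4"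
  shows "(\<Sum>k=0..K. \<Sum>s<S. mean_g2 k s) \<le> 2 * (mean_F 0 0 - f_inf) / \<alpha>"
proof -
  have next_k: "mean_F (Suc k) 0 = mean_F k S" for k
    unfolding mean_F_def by (intro Bochner_Integration.integral_cong refl) (simp add: outer_step)
  have "\<alpha> / 2 * (\<Sum>k=0..K. \<Sum>s<S. mean_g2 k s) = (\<Sum>k<Suc K. \<alpha> / 2 * (\<Sum>s<S. mean_g2 k s))"
    by (simp add: sum_distrib_left atLeast0AtMost lessThan_Suc_atMost)
  also have "\<dots> \<le> (\<Sum>k<Suc K. mean_F k 0 - mean_F (Suc k) 0)"
    unfolding next_k by (intro sum_mono inner_loop_decrease[OF assms])
  also have "\<dots> = mean_F 0 0 - mean_F (Suc K) 0" by (rule sum_lessThan_telescope')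
  also have "\<dots> \<le> mean_F 0 0 - f_inf" using mean_F_ge by simp
  finally show ?thesis using radius_control_pos by (simp add: field_simps)
qed

end

section \<open>The choice of the constants\<close>

text \<open>The bound on the epoch length gives \<open>\<mu>0 \<mu>1 S \<le> n powr (\<gamma>/2)\<close>, so the distance that can be travelled
  in an epoch grows like the square root of the batch size, and the variance reduction \<open>1/b\<close>
  just balances it. The result does not involve \<open>\<mu>0\<close>, which is therefore still free
  to be chosen small afterwards.\<close>

lemma step_budget_le:
  fixes L c \<mu>0 \<mu>1 n :: real and b S :: nat
  assumes c: "0 < c" "0 \<le> L" "L \<le> c" and \<mu>: "0 < \<mu>0" "0 < \<mu>1" and n: "0 < n"
    and \<alpha>: "\<alpha> = \<mu>0 * \<mu>1 / (2 * c)"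
    and b: "real b = \<mu>1 * n powr \<gamma>"
    and S: "int S \<le> \<lfloor>n powr (3 * \<gamma> / 2) / (\<mu>0 * (real b + \<mu>0 * L\<^sup>2 * real b / (2 * c)))\<rfloor>"
  shows "L\<^sup>2 * \<alpha>\<^sup>2 * (real S)\<^sup>2 / real b \<le> 1 / (4 * \<mu>1)"
proof -
  define p where "p = n powr \<gamma>"
  have p: "0 < p" using n by (simp add: p_def)
  have bp: "real b = \<mu>1 * p" using b by (simp add: p_def)
  have b0: "0 < real b" using bp p \<mu> by simp
  have "real S \<le> n powr (3 * \<gamma> / 2) / (\<mu>0 * (real b + \<mu>0 * L\<^sup>2 * real b / (2 * c)))"
    using S by (simp add: le_floor_iff)
  also have "\<dots> \<le> n powr (3 * \<gamma> / 2) / (\<mu>0 * real b)"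
    using b0 \<mu> c by (intro divide_left_mono mult_left_mono mult_pos_pos add_pos_nonneg) auto
  finally have "real S * (\<mu>0 * real b) \<le> n powr (3 * \<gamma> / 2)"
    using b0 \<mu> by (simp add: pos_le_divide_eq)
  then have "(real S * (\<mu>0 * real b))\<^sup>2 \<le> (n powr (3 * \<gamma> / 2))\<^sup>2"
    using b0 \<mu> by (intro power_mono) auto
  also have "(n powr (3 * \<gamma> / 2))\<^sup>2 = p ^ 3"
    unfolding p_def by (simp add: power2_eq_square power3_eq_cube powr_add[symmetric])
  finally have "(real S)\<^sup>2 * \<mu>0\<^sup>2 * \<mu>1\<^sup>2 * p\<^sup>2 \<le> p * p\<^sup>2"
    by (simp add: bp power_mult_distrib power2_eq_square power3_eq_cube mult_ac)
  then have SS: "(real S)\<^sup>2 * \<mu>0\<^sup>2 * \<mu>1\<^sup>2 \<le> p"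
    using p by (simp add: mult_le_cancel_right)
  have "L\<^sup>2 * \<alpha>\<^sup>2 * (real S)\<^sup>2 = (L\<^sup>2 / (4 * c\<^sup>2)) * ((real S)\<^sup>2 * \<mu>0\<^sup>2 * \<mu>1\<^sup>2)"
    by (simp add: \<alpha> power_mult_distrib power_divide)
  also have "\<dots> \<le> (c\<^sup>2 / (4 * c\<^sup>2)) * p"
    using c p SS by (intro mult_mono divide_right_mono power_mono) auto
  also have "\<dots> = p / 4" using c by simp
  finally have "L\<^sup>2 * \<alpha>\<^sup>2 * (real S)\<^sup>2 / real b \<le> p / 4 / real b"
    using b0 by (intro divide_right_mono) auto
  also have "\<dots> = 1 / (4 * \<mu>1)" using p by (simp add: bp)
  finally show ?thesis .
qed

theorem theorem4p5:
  fixes L \<kappa>\<^sub>H \<mu>1 \<gamma> :: real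
  assumes "0 \<le> L" and "0 \<le> \<kappa>\<^sub>H" and "0 < L + 2 * \<kappa>\<^sub>H"
    and "0 < \<mu>1" "\<mu>1 \<le> 1" and "0 < \<gamma>" "\<gamma> \<le> 1"
  shows "\<exists>\<mu>0 v0 :: real. 0 < \<mu>0 \<and> \<mu>0 < 1 \<and> 0 < v0 \<and> v0 < 1 \<and>
    (\<forall>(N::nat) (b::nat) (S::nat) (\<alpha>::real) (f_inf::real) (X :: (real^'d) set)
       (f :: nat \<Rightarrow> real^'d \<Rightarrow> real) (M :: 'w measure)
       (x :: nat \<Rightarrow> nat \<Rightarrow> 'w \<Rightarrow> real^'d) (I :: nat \<Rightarrow> nat \<Rightarrow> 'w \<Rightarrow> nat set)
       (H :: nat \<Rightarrow> nat \<Rightarrow> 'w \<Rightarrow> real^'d^'d).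
       trsvr M N b S \<alpha> f x I H \<longrightarrow>
       regularity M N S L \<kappa>\<^sub>H f_inf X f x H \<longrightarrow>
       unbiased M N b S f x I \<longrightarrow>
       integrable M (\<lambda>\<omega>. avg N f (x 0 0 \<omega>)) \<longrightarrow>
       \<alpha> = \<mu>0 * real b / (2 * (L + 2 * \<kappa>\<^sub>H) * real N powr \<gamma>) \<longrightarrow>
       real b = \<mu>1 * real N powr \<gamma> \<longrightarrow>
       int S \<le> \<lfloor>real N powr (3 * \<gamma> / 2) /
                (\<mu>0 * (real b + \<mu>0 * L^2 * real b / (2 * (L + 2 * \<kappa>\<^sub>H))))\<rfloor> \<longrightarrow>
       0 < \<alpha> \<and> \<alpha> \<le> 1 \<and>
       (\<forall>K::nat.
          integrable M (\<lambda>\<omega>. 1 / (real (K + 1) * real S) *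
            (\<Sum>k=0..K. \<Sum>s<S. (norm (gradient (avg N f) (x k s \<omega>)))^2)) \<and>
          (\<integral>\<omega>. 1 / (real (K + 1) * real S) *
            (\<Sum>k=0..K. \<Sum>s<S. (norm (gradient (avg N f) (x k s \<omega>)))^2) \<partial>M)
          \<le> 2 * (L + \<kappa>\<^sub>H) * ((\<integral>\<omega>. avg N f (x 0 0 \<omega>) \<partial>M) - f_inf) /
            (real (K + 1) * real S * \<mu>0 * \<mu>1 * v0)))"
proof -
  define c where "c = L + 2 * \<kappa>\<^sub>H"
  \<comment> \<open>The exponential is the reciprocal of the bound on the Gronwall factor of an epoch, so the noise and the
    deviation of the steps from \<open>- \<alpha> q\<close> consume at most half of the descent.\<close>
  define \<delta> where "\<delta> = exp (- 1 / (4 * \<mu>1)) / 4"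
  \<comment> \<open>The first bound makes the steps nearly parallel to \<open>- q\<close>, the second gives \<open>\<alpha> \<le> 1\<close>.\<close>
  define \<mu>0 where "\<mu>0 = min (\<delta>\<^sup>2) (2 * c)"
  have c: "0 < c" "L \<le> c" "2 * \<kappa>\<^sub>H \<le> c" using assms by (auto simp: c_def)
  have \<delta>: "0 < \<delta>" "\<delta> < 1"
  proof -
    have "exp (- 1 / (4 * \<mu>1)) < 1" using assms(4) by simp
    then show "0 < \<delta>" "\<delta> < 1" unfolding \<delta>_def by (simp, linarith)
  qed
  have \<delta>2: "\<delta>\<^sup>2 \<le> \<delta>" using \<delta> by (simp add: power2_eq_square mult_left_le)
  then have "\<delta>\<^sup>2 < 1" using \<delta>(2) by linarith
  then have \<mu>0: "0 < \<mu>0" "\<mu>0 < 1" "\<mu>0 \<le> \<delta>\<^sup>2" "\<mu>0 \<le> 2 * c" using \<delta> \<delta>2 c by (auto simp: \<mu>0_def)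
  \<comment> \<open>The value \<open>1/4\<close> absorbs the factor lost in the descent and the ratio of \<open>c\<close> to \<open>L + \<kappa>\<^sub>H\<close>.\<close>
  show ?thesis
  proof (rule exI[of _ \<mu>0], rule exI[of _ "1 / 4 :: real"], intro conjI allI impI)
    fix N b S :: nat and \<alpha> f_inf :: real and X :: "(real^'d) set"
      and f :: "nat \<Rightarrow> real^'d \<Rightarrow> real" and M :: "'w measure"
      and x :: "nat \<Rightarrow> nat \<Rightarrow> 'w \<Rightarrow> real^'d" and I :: "nat \<Rightarrow> nat \<Rightarrow> 'w \<Rightarrow> nat set"
      and H :: "nat \<Rightarrow> nat \<Rightarrow> 'w \<Rightarrow> real^'d^'d" and K :: nat
    assume run: "trsvr M N b S \<alpha> f x I H"
      and reg: "regularity M N S L \<kappa>\<^sub>H f_inf X f x H"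
      and start: "integrable M (\<lambda>\<omega>. avg N f (x 0 0 \<omega>))"
      and \<alpha>: "\<alpha> = \<mu>0 * real b / (2 * (L + 2 * \<kappa>\<^sub>H) * real N powr \<gamma>)"
      and b: "real b = \<mu>1 * real N powr \<gamma>"
      and S: "int S \<le> \<lfloor>real N powr (3 * \<gamma> / 2) /
                (\<mu>0 * (real b + \<mu>0 * L^2 * real b / (2 * (L + 2 * \<kappa>\<^sub>H))))\<rfloor>"
    interpret regular_trsvr M N b S \<alpha> f x I H L \<kappa>\<^sub>H f_inf X
      using run reg start by (intro regular_trsvr.intro regular_trsvr_axioms.intro)
    have \<alpha>_eq: "\<alpha> = \<mu>0 * \<mu>1 / (2 * c)" using N_pos by (simp add: \<alpha> b c_def)
    show "0 < \<alpha>" by (rule radius_control_pos)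
    have \<mu>01: "\<mu>0 * \<mu>1 \<le> \<mu>0" using \<mu>0 assms(5) by simp
    have "\<mu>0 * \<mu>1 \<le> 2 * c" using \<mu>01 \<mu>0 by linarith
    then show "\<alpha> \<le> 1" using c by (simp add: \<alpha>_eq)
    have scaled: "z * \<alpha> \<le> \<delta>\<^sup>2" if "z \<le> c" for z
    proof -
      have "z * \<alpha> \<le> c * \<alpha>" using that radius_control_pos by (intro mult_right_mono) auto
      also have "\<dots> = \<mu>0 * \<mu>1 / 2" using c by (simp add: \<alpha>_eq)
      also have "\<dots> \<le> \<delta>\<^sup>2" using \<mu>01 \<mu>0 by linarith
      finally show ?thesis .
    qed
    have "exp (L\<^sup>2 * \<alpha>\<^sup>2 * (real S)\<^sup>2 / real b) \<le> exp (1 / (4 * \<mu>1))"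
      using step_budget_le[OF c(1) assms(1) c(2) \<mu>0(1) assms(4) _ \<alpha>_eq b S[folded c_def]] N_pos by simp
    then have "\<delta> * exp (L\<^sup>2 * \<alpha>\<^sup>2 * (real S)\<^sup>2 / real b) \<le> \<delta> * exp (1 / (4 * \<mu>1))"
      using \<delta> by (intro mult_left_mono) auto
    also have "\<dots> = 1 / 4" by (simp add: \<delta>_def exp_minus)
    finally have small: "\<delta> * exp (L\<^sup>2 * \<alpha>\<^sup>2 * (real S)\<^sup>2 / real b) \<le> 1 / 4" .
    have total: "(\<Sum>k=0..K. \<Sum>s<S. mean_g2 k s) \<le> 2 * (mean_F 0 0 - f_inf) / \<alpha>"
      using \<delta> \<delta>2 c scaled[of "2 * \<kappa>\<^sub>H"] scaled[of L] by (intro sum_mean_g2_le[OF _ _ _ small]) auto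
    have intg: "integrable M (\<lambda>\<omega>. (norm (g (x k s \<omega>)))\<^sup>2)" if "s < S" for k s
      using that by (intro integrable_g integrable_F) auto
    show "integrable M (\<lambda>\<omega>. 1 / (real (K + 1) * real S) *
            (\<Sum>k=0..K. \<Sum>s<S. (norm (gradient (avg N f) (x k s \<omega>)))^2))"
      by (intro integrable_mult_right Bochner_Integration.integrable_sum intg) auto
    have gap: "0 \<le> mean_F 0 0 - f_inf" using mean_F_ge[of 0] by simp
    have "(\<integral>\<omega>. 1 / (real (K + 1) * real S) *
            (\<Sum>k=0..K. \<Sum>s<S. (norm (gradient (avg N f) (x k s \<omega>)))^2) \<partial>M)
        = 1 / (real (K + 1) * real S) * (\<Sum>k=0..K. \<Sum>s<S. mean_g2 k s)"
      unfolding mean_g2_def using intg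
      by (subst integral_mult_right_zero, subst Bochner_Integration.integral_sum)
        (auto intro!: Bochner_Integration.integrable_sum sum.cong Bochner_Integration.integral_sum)
    also have "\<dots> \<le> 1 / (real (K + 1) * real S) * (2 * (mean_F 0 0 - f_inf) / \<alpha>)"
      by (intro mult_left_mono total) auto
    also have "\<dots> = 1 / (real (K + 1) * real S) * (4 * c * (mean_F 0 0 - f_inf) / (\<mu>0 * \<mu>1))"
      by (simp add: \<alpha>_eq)
    also have "\<dots> \<le> 1 / (real (K + 1) * real S) * (8 * (L + \<kappa>\<^sub>H) * (mean_F 0 0 - f_inf) / (\<mu>0 * \<mu>1))"
      using gap assms \<mu>0 by (intro mult_left_mono divide_right_mono mult_right_mono) (auto simp: c_def)
    also have "\<dots> = 2 * (L + \<kappa>\<^sub>H) * ((\<integral>\<omega>. avg N f (x 0 0 \<omega>) \<partial>M) - f_inf) /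
            (real (K + 1) * real S * \<mu>0 * \<mu>1 * (1 / 4))"
      by (simp add: mean_F_def mult_ac)
    finally show "(\<integral>\<omega>. 1 / (real (K + 1) * real S) *
            (\<Sum>k=0..K. \<Sum>s<S. (norm (gradient (avg N f) (x k s \<omega>)))^2) \<partial>M)
          \<le> 2 * (L + \<kappa>\<^sub>H) * ((\<integral>\<omega>. avg N f (x 0 0 \<omega>) \<partial>M) - f_inf) /
            (real (K + 1) * real S * \<mu>0 * \<mu>1 * (1 / 4))" .
  qed (use \<mu>0 in auto)
qed

end
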